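(* Let $\widetilde{V}$ be the Voronoi tessellation determined by $\widetilde{\mathcal S}\subset\mathbb{H}^2$ closed and discrete, and let $\widetilde{V}^{(1)}_n$ be the union of its non-centered edges. Each component $T$ of $\widetilde{V}^{(1)}_n$ is a tree. If $\widetilde{\mathcal S} = \pi^{-1}(\mathcal S)$, where $\pi:\mathbb{H}^2\to F$ is the (locally isometric) universal cover to a closed surface $F$ and $\mathcal S\subset F$ is finite, then $T$ is finite, it has a unique vertex $v_T$ such that $J_{v_T} > J_v$ for all $v\in T^{(0)}-\{v_T\}$, and $T$ projects homeomorphically to $F$.
   Context: For $\widetilde{\mathcal S}\subset\mathbb{H}^2$ closed and discrete and $x\in\widetilde{\mathcal S}$, let $V_x=\{p\in\mathbb{H}^2 : d(p,x)\le d(p,y)\ \text{for all } y\in\widetilde{\mathcal S}-\{x\}\}$, a convex polygon. The Voronoi tessellation $\widetilde V$ has $2$-cells the $V_x$, edges the nondegenerate intersections $V_x\cap V_y$ ($x\neq y$), and vertices the points $V_x\cap V_y\cap V_z$ ($x,y,z$ distinct). For each vertex $v$ there is $J_v>0$ such that, for $x\in\widetilde{\mathcal S}$, $v\in V_x$ iff $d(v,x)=J_v$. The geometric dual to an edge $e=V_x\cap V_y$ is the geodesic arc $\gamma_{xy}$ joining $x$ to $y$. An edge $e=V_x\cap V_y$ is centered if $e$ intersects $\gamma_{xy}$ at a point in the interior of $e$, and non-centered otherwise. *)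

theory Defs
  imports "HOL-Analysis.Analysis"
begin

section \<open>The hyperbolic plane\<close>

text \<open>
  The hyperboloid model: the upper sheet of \<open>t\<^sup>2 - |z|\<^sup>2 = 1\<close> in \<open>\<real>\<^sup>2 \<times> \<real>\<close>, where
  \<open>cosh d\<close> is the negative of the Lorentzian inner product.
\<close>

typedef hyp_plane = "{p :: (real^2) \<times> real. 0 < snd p \<and> (snd p)\<^sup>2 = 1 + (norm (fst p))\<^sup>2}"
  by (rule exI[of _ "(0, 1)"]) simp

definition lorentz :: "(real^2) \<times> real \<Rightarrow> (real^2) \<times> real \<Rightarrow> real" where
  "lorentz p q = snd p * snd q - fst p \<bullet> fst q"

lemma lorentz_commute: "lorentz p q = lorentz q p"
  by (simp add: lorentz_def inner_commute mult.commute)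

lemma lorentz_orth_nonneg:
  fixes y z :: "real^2" and s :: real
  assumes "0 < s" "s\<^sup>2 = 1 + (norm y)\<^sup>2"
  shows "(z \<bullet> y)\<^sup>2 + (norm z)\<^sup>2 \<le> s\<^sup>2 * (norm z)\<^sup>2"
proof -
  have "(z \<bullet> y)\<^sup>2 \<le> (norm z)\<^sup>2 * (norm y)\<^sup>2"
    by (metis Cauchy_Schwarz_ineq power2_norm_eq_inner)
  then show ?thesis using assms by (simp add: algebra_simps)
qed

text \<open>Cauchy--Schwarz on the spacelike orthogonal complement of a point \<open>(y, s)\<close> of the hyperboloid.\<close>

lemma lorentz_orth_Cauchy_Schwarz:
  fixes y z w :: "real^2" and s a b :: real
  assumes s: "0 < s" "s\<^sup>2 = 1 + (norm y)\<^sup>2"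
    and z: "a * s = z \<bullet> y" and w: "b * s = w \<bullet> y"
  shows "(z \<bullet> w - a * b)\<^sup>2 \<le> (z \<bullet> z - a\<^sup>2) * (w \<bullet> w - b\<^sup>2)"
proof -
  have ge: "(norm v)\<^sup>2 \<le> s\<^sup>2 * (v \<bullet> v - c\<^sup>2)" if "c * s = v \<bullet> y" for v :: "real^2" and c
  proof -
    have "(c * s)\<^sup>2 + (norm v)\<^sup>2 \<le> s\<^sup>2 * (norm v)\<^sup>2"
      using lorentz_orth_nonneg[OF s, of v] that by simp
    then show ?thesis by (simp add: power2_norm_eq_inner algebra_simps power_mult_distrib)
  qed
  have nonneg: "0 \<le> v \<bullet> v - c\<^sup>2" if "c * s = v \<bullet> y" for v :: "real^2" and c
    using ge[OF that] s by (smt (verit) zero_le_power2 zero_less_power2 zero_le_mult_iff)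
  define W where "W = w \<bullet> w - b\<^sup>2"
  define Z where "Z = z \<bullet> z - a\<^sup>2"
  define X where "X = z \<bullet> w - a * b"
  show ?thesis
  proof (cases "W = 0")
    case True
    then have "w = 0" using ge[OF w] by (simp add: W_def)
    moreover from this w s have "b = 0" by simp
    ultimately show ?thesis by simp
  next
    case False
    then have W: "0 < W" using nonneg[OF w] by (simp add: W_def)
    have "(W * a - X * b) * s = (W *\<^sub>R z - X *\<^sub>R w) \<bullet> y"
      using z w by (simp add: inner_diff_left left_diff_distrib mult.assoc)
    from nonneg[OF this] have
      "0 \<le> W * W * (z \<bullet> z) - 2 * W * X * (z \<bullet> w) + X * X * (w \<bullet> w) - (W * a - X * b)\<^sup>2"
      by (simp add: inner_diff_left inner_diff_right inner_commute algebra_simps)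
    also have "\<dots> = W * W * Z - 2 * W * X * X + X * X * W"
      by (simp add: W_def Z_def X_def power2_eq_square algebra_simps)
    also have "\<dots> = W * (Z * W - X\<^sup>2)" by (simp add: power2_eq_square algebra_simps)
    finally show ?thesis using W by (simp add: zero_le_mult_iff W_def Z_def X_def)
  qed
qed

lemma Rep_hyp_plane_inner:
  "0 < snd (Rep_hyp_plane p)"
  "fst (Rep_hyp_plane p) \<bullet> fst (Rep_hyp_plane p) = snd (Rep_hyp_plane p) * snd (Rep_hyp_plane p) - 1"
  using Rep_hyp_plane[of p] by (auto simp: dot_square_norm power2_eq_square)

lemma lorentz_Rep_self: "lorentz (Rep_hyp_plane p) (Rep_hyp_plane p) = 1"
  by (simp add: lorentz_def Rep_hyp_plane_inner)

lemma lorentz_triangle: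
  fixes p q r :: hyp_plane
  defines "P \<equiv> Rep_hyp_plane p" and "Q \<equiv> Rep_hyp_plane q" and "R \<equiv> Rep_hyp_plane r"
  shows "(lorentz P R - lorentz P Q * lorentz Q R)\<^sup>2
           \<le> ((lorentz P Q)\<^sup>2 - 1) * ((lorentz Q R)\<^sup>2 - 1)"
proof -
  define a where "a = lorentz P Q"
  define b where "b = lorentz R Q"
  have Q: "0 < snd Q" "(snd Q)\<^sup>2 = 1 + (norm (fst Q))\<^sup>2"
    using Rep_hyp_plane[of q] by (auto simp: Q_def)
  have QQ: "fst Q \<bullet> fst Q = snd Q * snd Q - 1"
    by (simp add: Q_def Rep_hyp_plane_inner)
  have PP: "fst P \<bullet> fst P = snd P * snd P - 1" and RR: "fst R \<bullet> fst R = snd R * snd R - 1"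
    by (simp_all add: P_def R_def Rep_hyp_plane_inner)
  have PQ: "fst P \<bullet> fst Q = snd P * snd Q - a" "fst Q \<bullet> fst P = snd P * snd Q - a"
    and RQ: "fst R \<bullet> fst Q = snd R * snd Q - b" "fst Q \<bullet> fst R = snd R * snd Q - b"
    by (simp_all add: a_def b_def lorentz_def inner_commute)
  have PR: "fst P \<bullet> fst R = snd P * snd R - lorentz P R"
    by (simp add: lorentz_def)
  have 1: "(snd P - a * snd Q) * snd Q = (fst P - a *\<^sub>R fst Q) \<bullet> fst Q"
    by (simp add: inner_diff_left PQ QQ algebra_simps)
  have 2: "(snd R - b * snd Q) * snd Q = (fst R - b *\<^sub>R fst Q) \<bullet> fst Q"
    by (simp add: inner_diff_left RQ QQ algebra_simps)
  have "(a * b - lorentz P R)\<^sup>2 \<le> (a\<^sup>2 - 1) * (b\<^sup>2 - 1)"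
    using lorentz_orth_Cauchy_Schwarz[OF Q 1 2]
    by (simp add: inner_diff_left inner_diff_right PQ RQ QQ PP RR PR power2_eq_square algebra_simps)
  moreover have "b = lorentz Q R" by (simp add: b_def lorentz_commute)
  ultimately show ?thesis by (simp add: a_def power2_commute)
qed

lemma lorentz_ge_1: "1 \<le> lorentz (Rep_hyp_plane p) (Rep_hyp_plane q)"
proof -
  obtain z t where P: "Rep_hyp_plane p = (z, t)" by (cases "Rep_hyp_plane p")
  obtain w u where Q: "Rep_hyp_plane q = (w, u)" by (cases "Rep_hyp_plane q")
  have t: "0 < t" "t\<^sup>2 = 1 + (norm z)\<^sup>2" and u: "0 < u" "u\<^sup>2 = 1 + (norm w)\<^sup>2"
    using Rep_hyp_plane[of p] Rep_hyp_plane[of q] by (auto simp: P Q)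
  have "(t * u)\<^sup>2 = (1 + norm z * norm w)\<^sup>2 + (norm z - norm w)\<^sup>2"
    unfolding power_mult_distrib t u by (simp add: power2_eq_square algebra_simps)
  then have "(1 + norm z * norm w)\<^sup>2 \<le> (t * u)\<^sup>2" by simp
  then have "1 + norm z * norm w \<le> t * u"
    using t u by (meson mult_pos_pos less_imp_le power2_le_imp_le)
  then show ?thesis
    using norm_cauchy_schwarz[of z w] by (simp add: lorentz_def P Q)
qed

lemma lorentz_eq_1_iff: "lorentz (Rep_hyp_plane p) (Rep_hyp_plane q) = 1 \<longleftrightarrow> p = q"
proof
  assume eq: "lorentz (Rep_hyp_plane p) (Rep_hyp_plane q) = 1"
  obtain z t where P: "Rep_hyp_plane p = (z, t)" by (cases "Rep_hyp_plane p")
  obtain w u where Q: "Rep_hyp_plane q = (w, u)" by (cases "Rep_hyp_plane q")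
  have t: "0 < t" "t\<^sup>2 = 1 + z \<bullet> z" and u: "0 < u" "u\<^sup>2 = 1 + w \<bullet> w"
    using Rep_hyp_plane[of p] Rep_hyp_plane[of q] by (auto simp: P Q power2_norm_eq_inner)
  have e: "z \<bullet> w = t * u - 1" using eq by (simp add: lorentz_def P Q)
  define D where "D = u *\<^sub>R z - t *\<^sub>R w"
  have "D \<bullet> D = u\<^sup>2 * (z \<bullet> z) - 2 * t * u * (z \<bullet> w) + t\<^sup>2 * (w \<bullet> w)"
    by (simp add: D_def inner_diff_left inner_diff_right inner_commute power2_eq_square algebra_simps)
  also have "\<dots> = u\<^sup>2 * (t\<^sup>2 - 1) - 2 * t * u * (t * u - 1) + t\<^sup>2 * (u\<^sup>2 - 1)"
    using t u e by simp
  also have "\<dots> = - (t - u)\<^sup>2" by (simp add: power2_eq_square algebra_simps)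
  finally have D: "D \<bullet> D = - (t - u)\<^sup>2" .
  then have "t = u" by (smt (verit) inner_ge_zero zero_eq_power2 zero_le_power2)
  moreover from this D have "D = 0" by simp
  ultimately have "z = w" using u by (simp add: D_def)
  with \<open>t = u\<close> have "Rep_hyp_plane p = Rep_hyp_plane q" by (simp add: P Q)
  then show "p = q" by (simp add: Rep_hyp_plane_inject)
qed (simp add: lorentz_Rep_self)

instantiation hyp_plane :: metric_space
begin

definition dist_hyp_plane :: "hyp_plane \<Rightarrow> hyp_plane \<Rightarrow> real" where
  "dist_hyp_plane p q = arcosh (lorentz (Rep_hyp_plane p) (Rep_hyp_plane q))"

definition uniformity_hyp_plane :: "(hyp_plane \<times> hyp_plane) filter" where
  "uniformity_hyp_plane = (INF e\<in>{0<..}. principal {(x, y). dist x y < e})"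

definition open_hyp_plane :: "hyp_plane set \<Rightarrow> bool" where
  "open_hyp_plane U \<longleftrightarrow> (\<forall>x\<in>U. \<forall>\<^sub>F (x', y) in uniformity. x' = x \<longrightarrow> y \<in> U)"

instance
proof
  show "uniformity = (INF e\<in>{0<..}. principal {(x, y :: hyp_plane). dist x y < e})"
    by (rule uniformity_hyp_plane_def)
  show "open U \<longleftrightarrow> (\<forall>x\<in>U. \<forall>\<^sub>F (x', y) in uniformity. x' = x \<longrightarrow> y \<in> U)" for U :: "hyp_plane set"
    by (rule open_hyp_plane_def)
  show "dist x y = 0 \<longleftrightarrow> x = y" for x y :: hyp_plane
    by (simp add: dist_hyp_plane_def lorentz_ge_1 lorentz_eq_1_iff)
  show "dist x y \<le> dist x z + dist y z" for x y z :: hyp_plane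
  proof -
    let ?L = "\<lambda>x y. lorentz (Rep_hyp_plane x) (Rep_hyp_plane y)"
    have ge: "1 \<le> ?L a b" for a b by (rule lorentz_ge_1)
    have cosh: "cosh (dist x z + dist y z)
        = ?L x z * ?L z y + sqrt (((?L x z)\<^sup>2 - 1) * ((?L z y)\<^sup>2 - 1))"
      by (simp add: dist_hyp_plane_def cosh_add sinh_arcosh_real ge real_sqrt_mult
          lorentz_commute[of "Rep_hyp_plane y"])
    have "\<bar>?L x y - ?L x z * ?L z y\<bar> \<le> sqrt (((?L x z)\<^sup>2 - 1) * ((?L z y)\<^sup>2 - 1))"
      using lorentz_triangle[of x y z] by (simp add: real_le_rsqrt)
    then have "cosh (dist x y) \<le> cosh (dist x z + dist y z)"
      unfolding cosh by (simp add: dist_hyp_plane_def ge)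
    moreover have "0 \<le> dist a b" for a b :: hyp_plane by (simp add: dist_hyp_plane_def ge)
    ultimately show ?thesis by (simp add: cosh_real_nonneg_le_iff)
  qed
qed

end

text \<open>
  The image of a unit-speed geodesic from \<open>x\<close> to \<open>y\<close>; in the hyperbolic plane there is exactly
  one such geodesic.
\<close>

definition geodesic_arc :: "'a::metric_space \<Rightarrow> 'a \<Rightarrow> 'a set" where
  "geodesic_arc x y = {g t | g t. t \<in> {0..dist x y} \<and> g 0 = x \<and> g (dist x y) = y \<and>
     (\<forall>r\<in>{0..dist x y}. \<forall>s\<in>{0..dist x y}. dist (g r) (g s) = \<bar>r - s\<bar>)}"


section \<open>The Voronoi tessellation\<close>

definition vor_cell :: "hyp_plane set \<Rightarrow> hyp_plane \<Rightarrow> hyp_plane set" where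
  "vor_cell S x = {p. \<forall>y\<in>S - {x}. dist p x \<le> dist p y}"

definition vor_edges :: "hyp_plane set \<Rightarrow> hyp_plane set set" where
  "vor_edges S = {vor_cell S x \<inter> vor_cell S y | x y. x \<in> S \<and> y \<in> S \<and> x \<noteq> y \<and>
     (\<exists>p\<in>vor_cell S x \<inter> vor_cell S y. \<exists>q\<in>vor_cell S x \<inter> vor_cell S y. p \<noteq> q)}"

definition vor_vertices :: "hyp_plane set \<Rightarrow> hyp_plane set" where
  "vor_vertices S = {v. \<exists>x\<in>S. \<exists>y\<in>S. \<exists>z\<in>S. x \<noteq> y \<and> y \<noteq> z \<and> x \<noteq> z \<and>
     v \<in> vor_cell S x \<inter> vor_cell S y \<inter> vor_cell S z}"

definition vor_radius :: "hyp_plane set \<Rightarrow> hyp_plane \<Rightarrow> real" where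
  "vor_radius S v = (THE J. 0 < J \<and> (\<forall>x\<in>S. v \<in> vor_cell S x \<longleftrightarrow> dist v x = J))"

text \<open>
  An edge is a closed interval of a geodesic (a segment, a ray or a whole line). Its interior is the
  interior of this interval: it consists of the points of \<open>e\<close> other than its endpoints, that is,
  those lying strictly between two points of \<open>e\<close>.
\<close>

definition edge_interior :: "hyp_plane set \<Rightarrow> hyp_plane set" where
  "edge_interior e = {p \<in> e. \<exists>a\<in>e. \<exists>b\<in>e. a \<noteq> p \<and> b \<noteq> p \<and> p \<in> geodesic_arc a b}"

definition centered_edge :: "hyp_plane set \<Rightarrow> hyp_plane set \<Rightarrow> bool" where
  "centered_edge S e \<longleftrightarrow> e \<in> vor_edges S \<and>
     (\<exists>x\<in>S. \<exists>y\<in>S. x \<noteq> y \<and> e = vor_cell S x \<inter> vor_cell S y \<and>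
        geodesic_arc x y \<inter> edge_interior e \<noteq> {})"

definition noncentered_edges :: "hyp_plane set \<Rightarrow> hyp_plane set set" where
  "noncentered_edges S = {e \<in> vor_edges S. \<not> centered_edge S e}"


section \<open>Subgraphs of the one-skeleton\<close>

text \<open>For a union \<open>T\<close> of non-centered edges, its vertex set and its edge set.\<close>

definition vertices_of :: "hyp_plane set \<Rightarrow> hyp_plane set \<Rightarrow> hyp_plane set" where
  "vertices_of S T = vor_vertices S \<inter> T"

definition edges_of :: "hyp_plane set \<Rightarrow> hyp_plane set \<Rightarrow> hyp_plane set set" where
  "edges_of S T = {e \<in> noncentered_edges S. e \<subseteq> T}"

text \<open>
  Undirected graphs are given by a vertex set \<open>V\<close> and a set \<open>E\<close> of edges, each edge being a point
  set; a vertex and an edge are incident if the vertex lies on the edge. Multiple edges are allowed,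
  and so are edges with a single vertex: a Voronoi edge may be a geodesic ray. Such an edge is not a
  loop (a geodesic has none), so that cycles have length at least two.
\<close>

definition graph_connected :: "'a set \<Rightarrow> 'a set set \<Rightarrow> bool" where
  "graph_connected V E \<longleftrightarrow> V \<noteq> {} \<and>
     (\<forall>u\<in>V. \<forall>v\<in>V. (u, v) \<in> {(a, b). a \<in> V \<and> b \<in> V \<and> (\<exists>e\<in>E. a \<in> e \<and> b \<in> e)}\<^sup>*)"

definition graph_cycle :: "'a set \<Rightarrow> 'a set set \<Rightarrow> 'a list \<Rightarrow> 'a set list \<Rightarrow> bool" where
  "graph_cycle V E vs es \<longleftrightarrow> 2 \<le> length vs \<and> length es = length vs \<and>
     distinct vs \<and> distinct es \<and> set vs \<subseteq> V \<and> set es \<subseteq> E \<and>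
     (\<forall>i<length vs. vs ! i \<in> es ! i \<and> vs ! (Suc i mod length vs) \<in> es ! i)"

definition graph_tree :: "'a set \<Rightarrow> 'a set set \<Rightarrow> bool" where
  "graph_tree V E \<longleftrightarrow> graph_connected V E \<and> (\<nexists>vs es. graph_cycle V E vs es)"


section \<open>Closed surfaces and their hyperbolic universal covers\<close>

definition closed_surface :: "'a::metric_space set \<Rightarrow> bool" where
  "closed_surface F \<longleftrightarrow> compact F \<and> connected F \<and>
     (\<forall>p\<in>F. \<exists>U. openin (top_of_set F) U \<and> p \<in> U \<and> U homeomorphic (ball 0 1 :: (real^2) set))"

definition locally_isometric :: "('a::metric_space \<Rightarrow> 'b::metric_space) \<Rightarrow> bool" where
  "locally_isometric f \<longleftrightarrow>
     (\<forall>p. \<exists>U. open U \<and> p \<in> U \<and> (\<forall>a\<in>U. \<forall>b\<in>U. dist (f a) (f b) = dist a b))"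

text \<open>Universality is automatic, since the hyperbolic plane is simply connected.\<close>

definition hyperbolic_universal_cover :: "(hyp_plane \<Rightarrow> 'a::metric_space) \<Rightarrow> 'a set \<Rightarrow> bool" where
  "hyperbolic_universal_cover \<pi> F \<longleftrightarrow> covering_space UNIV \<pi> F \<and> locally_isometric \<pi>"

end

theory Submission
  imports Defs
begin

text \<open>
  Write \<open>h p\<close> for the distance from \<open>p\<close> to the set of sites, so that \<open>h v = J\<^sub>v\<close> at a vertex. On a
  non-centered edge \<open>V\<^sub>x \<inter> V\<^sub>y\<close> the function \<open>h\<close> is strictly monotone, because the edge lies on one
  side of the midpoint of \<open>x\<close> and \<open>y\<close> in their bisector. At most one such edge ascends from a given
  point \<open>v\<close>: if \<open>V\<^sub>x \<inter> V\<^sub>y\<close> ascends from \<open>v\<close>, then every site closest to \<open>v\<close> lies in the disc with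
  diameter \<open>xy\<close>, so two such edges have equally long duals with the same midpoint. Hence there are no
  cycles (look at a lowest vertex). In the cocompact case \<open>h\<close> takes finitely many values on the
  vertices, so a highest vertex exists in \<open>T\<close> and by connectedness every vertex climbs to it; this
  bounds \<open>T\<close>. If two points of \<open>T\<close> have the same image in \<open>F\<close>, the deck transformation that matches
  them preserves \<open>T\<close>, hence fixes the highest vertex, hence is the identity.
\<close>

section \<open>Lorentzian linear algebra\<close>

text \<open>Points are treated as vectors of R^3 with the form \<open>lorentz\<close>, which makes
  distance comparisons linear: p is closer to x than to y according to the sign of
  \<open>lorentz _ (y - x)\<close> at p. Along a geodesic, a point between two others is a positive
  combination of them, so such signs propagate. The disc with diameter xy is a half-space condition
  as well: with s = x + y in R^3, a positive multiple of the midpoint, z lies in the disc iff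
  \<open>lorentz s z <= lorentz s x\<close>. For two ascending edges this gives inequalities in both
  directions, which the reverse Cauchy-Schwarz inequality turns into s = s'. Edges may be rays. The
  lower end always exists and is a vertex, because the edge lies on one side of the midpoint; an
  upper end exists only once h is bounded. The tree statement therefore uses lower ends alone. A
  topological component must also be read as a connected graph. Local finiteness makes every union
  of edges closed, and distinct edges meet only in vertices, so an unreachable part of the graph
  would disconnect \<open>T\<close>.\<close>

lemma lorentz_simps:
  "lorentz (p + q) r = lorentz p r + lorentz q r" "lorentz r (p + q) = lorentz r p + lorentz r q"
  "lorentz (p - q) r = lorentz p r - lorentz q r" "lorentz r (p - q) = lorentz r p - lorentz r q"
  "lorentz (c *\<^sub>R p) r = c * lorentz p r" "lorentz r (c *\<^sub>R p) = c * lorentz r p"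
  "lorentz (- p) r = - lorentz p r" "lorentz r (- p) = - lorentz r p"
  "lorentz 0 r = 0" "lorentz r 0 = 0"
  by (simp_all add: lorentz_def inner_add_left inner_add_right inner_diff_left inner_diff_right algebra_simps)

text \<open>The form has signature (1,2) and is positive on the hyperboloid, so it is negative
  definite on the complement of a point. This is the source of every later uniqueness argument by
  \<open>r = 0\<close>.\<close>

lemma lorentz_spacelike:
  assumes "lorentz r (Rep_hyp_plane p) = 0"
  shows "lorentz r r \<le> 0" and "lorentz r r = 0 \<Longrightarrow> r = 0"
proof -
  obtain z t where P: "Rep_hyp_plane p = (z, t)" by (cases "Rep_hyp_plane p")
  obtain w u where R: "r = (w, u)" by (cases r)
  have t: "0 < t" "t\<^sup>2 = 1 + (norm z)\<^sup>2"
    using Rep_hyp_plane[of p] by (auto simp: P)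
  have eq: "u * t = w \<bullet> z" using assms by (simp add: P R lorentz_def)
  have "(u * t)\<^sup>2 + (norm w)\<^sup>2 \<le> t\<^sup>2 * (norm w)\<^sup>2"
    using lorentz_orth_nonneg[OF t, of w] eq by simp
  then have *: "(norm w)\<^sup>2 \<le> t\<^sup>2 * (- lorentz r r)"
    by (simp add: R lorentz_def dot_square_norm algebra_simps power2_eq_square)
  then have "0 \<le> t\<^sup>2 * (- lorentz r r)" by (meson order_trans zero_le_power2)
  with t(1) show "lorentz r r \<le> 0" by (simp add: mult_le_0_iff)
  show "r = 0" if "lorentz r r = 0"
  proof -
    have "w = 0" using * that by simp
    with eq t(1) show ?thesis by (simp add: R zero_prod_def)
  qed
qed

lemma cosh_dist: "cosh (dist p q) = lorentz (Rep_hyp_plane p) (Rep_hyp_plane q)"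
  by (simp add: dist_hyp_plane_def lorentz_ge_1)

lemma dist_le_iff_lorentz:
  "dist p q \<le> dist r s \<longleftrightarrow>
     lorentz (Rep_hyp_plane p) (Rep_hyp_plane q) \<le> lorentz (Rep_hyp_plane r) (Rep_hyp_plane s)"
  by (simp flip: cosh_dist add: cosh_real_nonneg_le_iff)

lemma dist_eq_iff_lorentz:
  "dist p q = dist r s \<longleftrightarrow>
     lorentz (Rep_hyp_plane p) (Rep_hyp_plane q) = lorentz (Rep_hyp_plane r) (Rep_hyp_plane s)"
  by (metis dist_le_iff_lorentz order_antisym order_refl)

lemma lorentz_gt_1: "p \<noteq> q \<Longrightarrow> 1 < lorentz (Rep_hyp_plane p) (Rep_hyp_plane q)"
  using lorentz_ge_1[of p q] lorentz_eq_1_iff[of p q] by linarith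

text \<open>The second hypothesis selects the sheet: if \<open>P\<close> were on the lower sheet,
  \<open>- P\<close> would be a point and its product with \<open>q\<close> at least 1.\<close>

lemma hyp_planeI:
  assumes "lorentz P P = 1" "0 < lorentz P (Rep_hyp_plane q)"
  obtains p where "Rep_hyp_plane p = P"
proof -
  have nn: "(snd P)\<^sup>2 = 1 + (norm (fst P))\<^sup>2"
    using assms(1) by (simp add: lorentz_def dot_square_norm power2_eq_square)
  have "0 < snd P"
  proof (rule ccontr)
    assume "\<not> 0 < snd P"
    moreover have "snd P \<noteq> 0" using nn by (smt (verit) zero_le_power2 zero_power2)
    ultimately have "- P \<in> {p. 0 < snd p \<and> (snd p)\<^sup>2 = 1 + (norm (fst p))\<^sup>2}" using nn by simp
    from Abs_hyp_plane_inverse[OF this] have "1 \<le> lorentz (- P) (Rep_hyp_plane q)"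
      by (metis lorentz_ge_1)
    then show False using assms(2) by (simp add: lorentz_simps)
  qed
  then have "P \<in> {p. 0 < snd p \<and> (snd p)\<^sup>2 = 1 + (norm (fst p))\<^sup>2}" using nn by simp
  from Abs_hyp_plane_inverse[OF this] show thesis by (rule that)
qed

section \<open>Cross products and the complement of two points\<close>

lemma parallel_if_cross_eq_0:
  fixes P Q :: "(real^2) \<times> real"
  assumes "Q \<noteq> 0" "fst P $ 1 * fst Q $ 2 = fst P $ 2 * fst Q $ 1"
    "fst P $ 2 * snd Q = snd P * fst Q $ 2" "snd P * fst Q $ 1 = fst P $ 1 * snd Q"
  shows "\<exists>c. P = c *\<^sub>R Q"
proof -
  have *: "(\<exists>c. P = c *\<^sub>R Q) \<longleftrightarrow>
      (\<exists>c. fst P $ 1 = c * fst Q $ 1 \<and> fst P $ 2 = c * fst Q $ 2 \<and> snd P = c * snd Q)"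
    by (auto simp: prod_eq_iff vec_eq_iff forall_2)
  have "fst Q $ 1 \<noteq> 0 \<or> fst Q $ 2 \<noteq> 0 \<or> snd Q \<noteq> 0"
    using assms(1) by (auto simp: prod_eq_iff vec_eq_iff forall_2)
  then show ?thesis unfolding *
  proof (elim disjE)
    assume "fst Q $ 1 \<noteq> 0" then show "\<exists>c. fst P $ 1 = c * fst Q $ 1 \<and> fst P $ 2 = c * fst Q $ 2 \<and> snd P = c * snd Q"
      using assms by (intro exI[of _ "fst P $ 1 / fst Q $ 1"]) (auto simp: field_simps)
  next
    assume "fst Q $ 2 \<noteq> 0" then show "\<exists>c. fst P $ 1 = c * fst Q $ 1 \<and> fst P $ 2 = c * fst Q $ 2 \<and> snd P = c * snd Q"
      using assms by (intro exI[of _ "fst P $ 2 / fst Q $ 2"]) (auto simp: field_simps)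
  next
    assume "snd Q \<noteq> 0" then show "\<exists>c. fst P $ 1 = c * fst Q $ 1 \<and> fst P $ 2 = c * fst Q $ 2 \<and> snd P = c * snd Q"
      using assms by (intro exI[of _ "snd P / snd Q"]) (auto simp: field_simps)
  qed
qed

lemma lorentz_coords:
  "lorentz P Q = snd P * snd Q - fst P $ 1 * fst Q $ 1 - fst P $ 2 * fst Q $ 2"
  by (simp add: lorentz_def inner_vec_def sum_2)

text \<open>In R^3 a vector v orthogonal to r and d is parallel to their cross product.
  Orthogonality is Lorentzian here, so the third component of the product changes sign; the
  conclusions say that v times this product vanishes.\<close>

lemma cross_cross:
  fixes r1 r2 r3 d1 d2 d3 v1 v2 v3 :: real
  assumes d: "v3 * d3 = v1 * d1 + v2 * d2" and r: "v3 * r3 = v1 * r1 + v2 * r2"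
  shows "v1 * (r3 * d1 - r1 * d3) = v2 * (r2 * d3 - r3 * d2)"
    and "v2 * - (r1 * d2 - r2 * d1) = v3 * (r3 * d1 - r1 * d3)"
    and "v3 * (r2 * d3 - r3 * d2) = v1 * - (r1 * d2 - r2 * d1)"
proof -
  have "v1 * (r3 * d1 - r1 * d3) - v2 * (r2 * d3 - r3 * d2)
      = r3 * (v1 * d1 + v2 * d2) - d3 * (v1 * r1 + v2 * r2)" by (simp add: algebra_simps)
  then show "v1 * (r3 * d1 - r1 * d3) = v2 * (r2 * d3 - r3 * d2)"
    unfolding d[symmetric] r[symmetric] by simp
  have "v3 * (r3 * d1 - r1 * d3) = d1 * (v3 * r3) - r1 * (v3 * d3)" by (simp add: algebra_simps)
  then show "v2 * - (r1 * d2 - r2 * d1) = v3 * (r3 * d1 - r1 * d3)"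
    unfolding d r by (simp add: algebra_simps)
  have "v3 * (r2 * d3 - r3 * d2) = r2 * (v3 * d3) - d2 * (v3 * r3)" by (simp add: algebra_simps)
  then show "v3 * (r2 * d3 - r3 * d2) = v1 * - (r1 * d2 - r2 * d1)"
    unfolding d r by (simp add: algebra_simps)
qed

lemma lorentz_complement_1dim:
  assumes "v \<noteq> w" "D \<noteq> 0"
    and R: "lorentz R (Rep_hyp_plane v) = 0" "lorentz R (Rep_hyp_plane w) = 0"
    and D: "lorentz D (Rep_hyp_plane v) = 0" "lorentz D (Rep_hyp_plane w) = 0"
  shows "\<exists>c. R = c *\<^sub>R D"
proof -
  define m1 where "m1 = fst R $ 2 * snd D - snd R * fst D $ 2"
  define m2 where "m2 = snd R * fst D $ 1 - fst R $ 1 * snd D"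
  define m3 where "m3 = fst R $ 1 * fst D $ 2 - fst R $ 2 * fst D $ 1"
  define M :: "(real^2) \<times> real" where "M = (vector [m1, m2], - m3)"
  have M: "fst M $ 1 = m1" "fst M $ 2 = m2" "snd M = - m3" by (simp_all add: M_def)
  have par: "\<exists>c. Rep_hyp_plane u = c *\<^sub>R M"
    if "M \<noteq> 0" "lorentz R (Rep_hyp_plane u) = 0" "lorentz D (Rep_hyp_plane u) = 0" for u
  proof -
    let ?u = "Rep_hyp_plane u"
    have "snd ?u * snd D = fst ?u $ 1 * fst D $ 1 + fst ?u $ 2 * fst D $ 2"
      "snd ?u * snd R = fst ?u $ 1 * fst R $ 1 + fst ?u $ 2 * fst R $ 2"
      using that(2,3) unfolding lorentz_coords by (simp_all add: algebra_simps)
    from cross_cross[OF this] show ?thesis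
      by (intro parallel_if_cross_eq_0[OF that(1)]) (simp_all only: M m1_def m2_def m3_def)
  qed
  have "M = 0"
  proof (rule ccontr)
    assume "M \<noteq> 0"
    then obtain a b where ab: "Rep_hyp_plane v = a *\<^sub>R M" "Rep_hyp_plane w = b *\<^sub>R M"
      using par R D by meson
    \<comment> \<open>If the Lorentzian cross product \<open>M\<close> of \<open>R\<close> and
      \<open>D\<close> is nonzero, both points are multiples of it. Unit multiples of one vector
      have product 1 or -1, and only 1 is possible on the upper sheet, where it means
      equality.\<close>
    then have "a * a * lorentz M M = 1" "b * b * lorentz M M = 1"
      using lorentz_Rep_self[of v] lorentz_Rep_self[of w] by (simp_all add: lorentz_simps mult.assoc)
    moreover have "lorentz (Rep_hyp_plane v) (Rep_hyp_plane w) = a * b * lorentz M M"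
      by (simp add: ab lorentz_simps)
    ultimately have "(lorentz (Rep_hyp_plane v) (Rep_hyp_plane w))\<^sup>2 = 1" by algebra
    then have "lorentz (Rep_hyp_plane v) (Rep_hyp_plane w) = 1"
      using lorentz_ge_1[of v w] by (auto simp: power2_eq_1_iff)
    then show False using assms(1) by (simp add: lorentz_eq_1_iff)
  qed
  then have "m1 = 0" "m2 = 0" "m3 = 0" using M by auto
  then show ?thesis
    by (intro parallel_if_cross_eq_0[OF assms(2)]) (auto simp: m1_def m2_def m3_def)
qed

text \<open>Both \<open>z - x\<close> and \<open>y - x\<close> are orthogonal to the centres
  \<open>v\<close> and \<open>w\<close>, hence proportional. So \<open>z\<close> lies on the affine
  line through \<open>x\<close> and \<open>y\<close> in R^3, which meets the hyperboloid only at
  these two points.\<close>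

lemma circles_meet_at_most_twice:
  fixes v :: hyp_plane
  assumes "v \<noteq> w" "x \<noteq> y"
    and "dist v x = dist v y" "dist v x = dist v z" "dist w x = dist w y" "dist w x = dist w z"
  shows "z = x \<or> z = y"
proof -
  let ?X = "Rep_hyp_plane x" and ?Y = "Rep_hyp_plane y" and ?Z = "Rep_hyp_plane z"
  have "?Y - ?X \<noteq> 0" using assms(2) by (simp add: Rep_hyp_plane_inject)
  moreover have "lorentz (?Z - ?X) (Rep_hyp_plane v) = 0" "lorentz (?Z - ?X) (Rep_hyp_plane w) = 0"
    "lorentz (?Y - ?X) (Rep_hyp_plane v) = 0" "lorentz (?Y - ?X) (Rep_hyp_plane w) = 0"
    using assms(3-) by (simp_all add: lorentz_simps dist_eq_iff_lorentz lorentz_commute)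
  ultimately obtain c where c: "?Z - ?X = c *\<^sub>R (?Y - ?X)"
    using lorentz_complement_1dim[OF assms(1)] by meson
  then have Z: "?Z = ?X + c *\<^sub>R (?Y - ?X)" by (simp add: algebra_simps)
  define k where "k = lorentz ?X ?Y"
  have "k > 1" unfolding k_def by (rule lorentz_gt_1[OF assms(2)])
  have "1 = lorentz ?Z ?Z" by (simp add: lorentz_Rep_self)
  also have "\<dots> = 1 + 2 * c * (k - 1) - 2 * c * c * (k - 1)"
    by (simp add: Z lorentz_simps lorentz_Rep_self lorentz_commute[of ?Y ?X] flip: k_def)
      (simp add: algebra_simps)
  finally have "c * (1 - c) * (k - 1) = 0" by algebra
  then have "c = 0 \<or> c = 1" using \<open>k > 1\<close> by auto
  then have "?Z = ?X \<or> ?Z = ?Y" by (auto simp: Z)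
  then show ?thesis by (simp add: Rep_hyp_plane_inject)
qed

text \<open>
  The reverse Cauchy--Schwarz inequality for the timelike vectors \<open>s\<close>, \<open>s'\<close>, with its equality case.
\<close>

lemma sum_eq_if_lorentz_le:
  fixes x y x' y' :: hyp_plane
  defines "s \<equiv> Rep_hyp_plane x + Rep_hyp_plane y" and "s' \<equiv> Rep_hyp_plane x' + Rep_hyp_plane y'"
  assumes "lorentz s s' \<le> lorentz s s" "lorentz s s' \<le> lorentz s' s'"
  shows "s = s'"
proof -
  define N where "N = lorentz s s"
  define N' where "N' = lorentz s' s'"
  define B where "B = lorentz s s'"
  have pos: "0 < N" "0 < N'" "0 < B"
    unfolding N_def N'_def B_def s_def s'_def lorentz_simps
    using lorentz_ge_1 by (smt (verit))+
  have pt: "\<exists>p. Rep_hyp_plane p = (1 / sqrt N) *\<^sub>R s"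
  proof (rule hyp_planeI)
    show "lorentz ((1 / sqrt N) *\<^sub>R s) ((1 / sqrt N) *\<^sub>R s) = 1"
      using pos by (simp add: lorentz_simps flip: N_def)
    have "0 < lorentz s (Rep_hyp_plane x)" unfolding s_def lorentz_simps
      using lorentz_ge_1 by (smt (verit))
    then show "0 < lorentz ((1 / sqrt N) *\<^sub>R s) (Rep_hyp_plane x)"
      using pos by (simp add: lorentz_simps)
  qed blast
  then obtain p where p: "Rep_hyp_plane p = (1 / sqrt N) *\<^sub>R s" by blast
  \<comment> \<open>The component of \<open>s'\<close> orthogonal to \<open>s\<close>. Being
    spacelike, it gives \<open>N' * N <= B * B\<close>, while the hypotheses give the opposite
    inequality; hence it is null and vanishes.\<close>
  define r where "r = s' - (B / N) *\<^sub>R s"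
  have "lorentz r (Rep_hyp_plane p) = 0"
    using pos by (simp add: p r_def lorentz_simps lorentz_commute[of s' s] flip: N_def B_def)
  note sp = lorentz_spacelike[OF this]
  have rr: "lorentz r r = N' - B * B / N"
    using pos by (simp add: r_def lorentz_simps lorentz_commute[of s' s] flip: N_def N'_def B_def)
  have le: "B \<le> N" "B \<le> N'" using assms by (simp_all add: N_def N'_def B_def)
  have "N' * N \<le> B * B" using sp(1) pos rr by (simp add: field_simps)
  moreover have "B * B \<le> B * N" "B * N \<le> N' * N" using le pos by (simp_all add: mult_mono)
  ultimately have "B * B = B * N" "B * N = N' * N" by linarith+
  then have "B = N" "N' = N" using pos by auto
  then have "lorentz r r = 0" using rr pos by simp
  then have "r = 0" by (rule sp(2))
  then show ?thesis using \<open>B = N\<close> pos by (simp add: r_def)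
qed

section \<open>Geodesics and bisectors\<close>

lemma cosh_real_inj_nonneg: "0 \<le> a \<Longrightarrow> 0 \<le> b \<Longrightarrow> cosh a = cosh b \<Longrightarrow> a = b" for a b :: real
  using cosh_real_nonneg_le_iff[of a b] cosh_real_nonneg_le_iff[of b a] by linarith

text \<open>\<open>U\<close> is a unit tangent vector at \<open>p\<close>, with norm -1 in this sign
  convention; the geodesic is the branch of the hyperbola in the plane spanned by \<open>p\<close>
  and \<open>U\<close>.\<close>

lemma geodesic_line:
  assumes U: "lorentz U U = - 1" "lorentz (Rep_hyp_plane p) U = 0"
  obtains q where "\<And>t. Rep_hyp_plane (q t) = cosh t *\<^sub>R Rep_hyp_plane p + sinh t *\<^sub>R U"
    "\<And>r s. dist (q r) (q s) = \<bar>r - s\<bar>"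
proof -
  let ?P = "\<lambda>t. cosh t *\<^sub>R Rep_hyp_plane p + sinh t *\<^sub>R U"
  have L: "lorentz (?P r) (?P s) = cosh (r - s)" for r s
    using U by (simp add: lorentz_simps lorentz_Rep_self lorentz_commute[of U "Rep_hyp_plane p"] cosh_diff algebra_simps)
  have "\<exists>q. Rep_hyp_plane q = ?P t" for t
  proof (rule hyp_planeI[of "?P t" p])
    show "lorentz (?P t) (?P t) = 1" using L[of t t] by simp
    show "0 < lorentz (?P t) (Rep_hyp_plane p)"
      by (simp add: lorentz_simps lorentz_Rep_self U lorentz_commute[of U "Rep_hyp_plane p"])
  qed blast
  then obtain q where q: "\<And>t. Rep_hyp_plane (q t) = ?P t" by metis
  have "cosh (dist (q r) (q s)) = cosh \<bar>r - s\<bar>" for r s by (simp add: cosh_dist q L)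
  from cosh_real_inj_nonneg[OF zero_le_dist abs_ge_zero this]
  have "dist (q r) (q s) = \<bar>r - s\<bar>" for r s .
  from that[OF q this] show thesis .
qed

lemma geodesic_line_through:
  assumes "p \<noteq> w"
  obtains q U where "q 0 = p" "q (dist p w) = w" "lorentz U U = - 1" "lorentz (Rep_hyp_plane p) U = 0"
    "\<And>t. Rep_hyp_plane (q t) = cosh t *\<^sub>R Rep_hyp_plane p + sinh t *\<^sub>R U"
    "\<And>r s. dist (q r) (q s) = \<bar>r - s\<bar>"
proof -
  define D where "D = dist p w"
  have D: "0 < sinh D" "cosh D = lorentz (Rep_hyp_plane p) (Rep_hyp_plane w)"
    using assms by (auto simp: D_def cosh_dist)
  define V where "V = Rep_hyp_plane w - cosh D *\<^sub>R Rep_hyp_plane p"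
  define U where "U = (1 / sinh D) *\<^sub>R V"
  have "lorentz V V = 1 - (cosh D)\<^sup>2"
    by (simp add: V_def lorentz_simps lorentz_Rep_self D lorentz_commute[of "Rep_hyp_plane w"] algebra_simps power2_eq_square)
  then have VV: "lorentz V V = - sinh D * sinh D" using hyperbolic_pythagoras[of D] by (simp add: power2_eq_square)
  have U: "lorentz U U = - 1" "lorentz (Rep_hyp_plane p) U = 0"
    using D by (simp add: U_def lorentz_simps VV) (simp add: U_def V_def lorentz_simps D lorentz_Rep_self)
  obtain q where q: "\<And>t. Rep_hyp_plane (q t) = cosh t *\<^sub>R Rep_hyp_plane p + sinh t *\<^sub>R U"
      "\<And>r s. dist (q r) (q s) = \<bar>r - s\<bar>"
    using geodesic_line[OF U] by blast
  have "Rep_hyp_plane (q 0) = Rep_hyp_plane p" "Rep_hyp_plane (q D) = Rep_hyp_plane w"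
    using D(1) by (simp_all add: q U_def V_def)
  then have "q 0 = p" "q (dist p w) = w" by (simp_all add: Rep_hyp_plane_inject D_def)
  from that[OF this U q] show thesis .
qed

lemma in_geodesic_arc:
  fixes q :: "real \<Rightarrow> 'a::metric_space"
  assumes q: "\<And>r s. dist (q r) (q s) = \<bar>r - s\<bar>" and "a \<le> t" "t \<le> b"
  shows "q t \<in> geodesic_arc (q a) (q b)"
proof -
  have D: "dist (q a) (q b) = b - a" using assms by simp
  have "t - a \<in> {0..b - a} \<and> q (a + 0) = q a \<and> q (a + (b - a)) = q b \<and>
      (\<forall>r\<in>{0..b - a}. \<forall>s\<in>{0..b - a}. dist (q (a + r)) (q (a + s)) = \<bar>r - s\<bar>)"
    using assms(2,3) by (simp add: q)
  moreover have "q t = q (a + (t - a))" by simp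
  ultimately show ?thesis unfolding geodesic_arc_def D
    by (intro CollectI exI[of _ "\<lambda>r. q (a + r)"] exI[of _ "t - a"] conjI) blast+
qed

text \<open>The hyperbolic substitute for a convex combination: the coefficients are nonnegative for
  \<open>a <= t <= b\<close>, so nonnegativity of a linear functional at both ends carries over to
  the points between.\<close>

lemma geodesic_line_convex:
  assumes "\<And>t. Rep_hyp_plane (q t) = cosh t *\<^sub>R P + sinh t *\<^sub>R U"
  shows "sinh (b - a) *\<^sub>R Rep_hyp_plane (q t)
       = sinh (b - t) *\<^sub>R Rep_hyp_plane (q a) + sinh (t - a) *\<^sub>R Rep_hyp_plane (q b)"
proof -
  have "sinh (b - a) * cosh t = sinh (b - t) * cosh a + sinh (t - a) * cosh b"
       "sinh (b - a) * sinh t = sinh (b - t) * sinh a + sinh (t - a) * sinh b"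
    unfolding sinh_diff by (simp_all add: algebra_simps)
  then show ?thesis
    unfolding assms scaleR_add_right scaleR_scaleR by (simp add: scaleR_left_distrib)
qed

text \<open>At half the distance the two coefficients of \<open>geodesic_line_convex\<close> agree.
  Hence sums of two sites stand for midpoints throughout.\<close>

lemma midpoint:
  assumes "x \<noteq> y"
  obtains m k where "m \<in> geodesic_arc x y" "0 < k" "Rep_hyp_plane m = k *\<^sub>R (Rep_hyp_plane x + Rep_hyp_plane y)"
proof -
  obtain q U where q: "q 0 = x" "q (dist x y) = y" "lorentz U U = - 1" "lorentz (Rep_hyp_plane x) U = 0"
      "\<And>t. Rep_hyp_plane (q t) = cosh t *\<^sub>R Rep_hyp_plane x + sinh t *\<^sub>R U"
      "\<And>r s. dist (q r) (q s) = \<bar>r - s\<bar>"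
    by (rule geodesic_line_through[OF assms], rule that, assumption+)
  define D where "D = dist x y"
  have D: "0 < D" using assms by (simp add: D_def)
  have "q (D/2) \<in> geodesic_arc (q 0) (q D)" by (rule in_geodesic_arc) (use q D in auto)
  then have arc: "q (D/2) \<in> geodesic_arc x y" by (simp add: q D_def)
  have "sinh D *\<^sub>R Rep_hyp_plane (q (D/2)) = sinh (D/2) *\<^sub>R (Rep_hyp_plane x + Rep_hyp_plane y)"
    using geodesic_line_convex[OF q(5), where a=0 and b=D and t="D/2"]
    by (simp add: q(1) q(2)[folded D_def] scaleR_add_right)
  then have "(1 / sinh D) *\<^sub>R (sinh D *\<^sub>R Rep_hyp_plane (q (D/2)))
      = (1 / sinh D) *\<^sub>R (sinh (D/2) *\<^sub>R (Rep_hyp_plane x + Rep_hyp_plane y))" by simp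
  then have "Rep_hyp_plane (q (D/2)) = (sinh (D/2) / sinh D) *\<^sub>R (Rep_hyp_plane x + Rep_hyp_plane y)"
    using D by simp
  then show thesis using that[OF arc, of "sinh (D/2) / sinh D"] D by simp
qed

text \<open>The bisector is the section of the hyperboloid by the plane orthogonal to
  \<open>x - y\<close>. The points \<open>p1\<close>, \<open>p2\<close> supply one of its points
  other than the midpoint, and so its direction \<open>U\<close>. The formula with \<open>c\<close>
  is the hyperbolic Pythagorean theorem: \<open>c\<close> is cosh of half the distance from
  \<open>x\<close> to \<open>y\<close>.\<close>

lemma bisector_line:
  assumes "x \<noteq> y" "p1 \<noteq> p2" "dist p1 x = dist p1 y" "dist p2 x = dist p2 y"
  obtains q U c k where "0 < k"
    "Rep_hyp_plane (q 0) = k *\<^sub>R (Rep_hyp_plane x + Rep_hyp_plane y)" "q 0 \<in> geodesic_arc x y"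
    "\<And>t. Rep_hyp_plane (q t) = cosh t *\<^sub>R Rep_hyp_plane (q 0) + sinh t *\<^sub>R U"
    "\<And>r s. dist (q r) (q s) = \<bar>r - s\<bar>"
    "0 < c" "\<And>t. cosh (dist (q t) x) = c * cosh t" "\<And>t. dist (q t) x = dist (q t) y"
    "\<And>p. dist p x = dist p y \<Longrightarrow> p \<in> range q"
proof -
  let ?X = "Rep_hyp_plane x" and ?Y = "Rep_hyp_plane y"
  obtain m k where m: "m \<in> geodesic_arc x y" "0 < k" "Rep_hyp_plane m = k *\<^sub>R (?X + ?Y)"
    using midpoint[OF assms(1)] .
  let ?M = "Rep_hyp_plane m"
  have "\<exists>w. m \<noteq> w \<and> dist w x = dist w y"
  proof (cases "m = p1")
    case True with assms show ?thesis by blast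
  next
    case False with assms show ?thesis by blast
  qed
  then obtain w where w: "m \<noteq> w" "dist w x = dist w y" by blast
  obtain q U where q: "q 0 = m" "q (dist m w) = w" "lorentz U U = - 1" "lorentz ?M U = 0"
      "\<And>t. Rep_hyp_plane (q t) = cosh t *\<^sub>R ?M + sinh t *\<^sub>R U"
      "\<And>r s. dist (q r) (q s) = \<bar>r - s\<bar>"
    by (rule geodesic_line_through[OF w(1)], rule that, assumption+)
  define D where "D = ?X - ?Y"
  have W: "Rep_hyp_plane w = cosh (dist m w) *\<^sub>R ?M + sinh (dist m w) *\<^sub>R U"
    using q(5)[of "dist m w"] q(2) by simp
  have sh: "sinh (dist m w) \<noteq> 0" using w(1) by simp
  have DM: "lorentz D ?M = 0"
    by (simp add: D_def m lorentz_simps lorentz_Rep_self lorentz_commute[of ?Y])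
  have DW: "lorentz D (Rep_hyp_plane w) = 0"
    using w(2) by (simp add: D_def lorentz_simps dist_eq_iff_lorentz lorentz_commute)
  then have DU: "lorentz D U = 0" using sh DM by (simp add: W lorentz_simps)
  have D0: "D \<noteq> 0" using assms(1) by (simp add: D_def Rep_hyp_plane_inject)
  \<comment> \<open>\<open>U\<close> is orthogonal to the difference of the sites and, since the
    midpoint is a multiple of it, to their sum.\<close>
  have UX: "lorentz U ?X = 0"
  proof -
    have "lorentz U ?X = lorentz U ?Y" using DU by (simp add: D_def lorentz_simps lorentz_commute)
    moreover have "lorentz U ?X + lorentz U ?Y = 0"
      using q(4) m(2) by (simp add: m lorentz_simps lorentz_commute)
    ultimately show ?thesis by linarith
  qed
  have "q 0 = m" by fact
  show thesis
  proof (rule that[of k q U "lorentz ?M ?X"])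
    show "0 < lorentz ?M ?X" using lorentz_ge_1[of m x] by linarith
    show "cosh (dist (q t) x) = lorentz ?M ?X * cosh t" for t
      by (simp add: cosh_dist q lorentz_simps UX)
    show "dist (q t) x = dist (q t) y" for t
    proof -
      have "lorentz (Rep_hyp_plane (q t)) D = 0"
        using DM DU by (simp add: q lorentz_simps lorentz_commute)
      then show ?thesis by (simp add: dist_eq_iff_lorentz D_def lorentz_simps)
    qed
    fix p assume p: "dist p x = dist p y"
    let ?P = "Rep_hyp_plane p"
    have DP: "lorentz D ?P = 0"
      using p by (simp add: D_def lorentz_simps dist_eq_iff_lorentz lorentz_commute)
    \<comment> \<open>\<open>A\<close> and \<open>B\<close> are the coordinates of the projection of
      \<open>p\<close> to the plane of the geodesic; the sign of \<open>B\<close> compensates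
      \<open>lorentz U U = - 1\<close>. The remainder \<open>R\<close> is a multiple of
      \<open>D\<close> and also orthogonal to \<open>D\<close>, so it is null and vanishes.\<close>
    define A where "A = lorentz ?P ?M"
    define B where "B = - lorentz ?P U"
    define R where "R = ?P - A *\<^sub>R ?M - B *\<^sub>R U"
    have RM: "lorentz R ?M = 0" using q(4) by (simp add: R_def lorentz_simps A_def lorentz_Rep_self lorentz_commute)
    have RU: "lorentz R U = 0" using q(3,4) by (simp add: R_def lorentz_simps B_def lorentz_commute)
    have RW: "lorentz R (Rep_hyp_plane w) = 0" using RM RU by (simp add: W lorentz_simps)
    obtain c where c: "R = c *\<^sub>R D"
      using lorentz_complement_1dim[OF w(1) D0 RM RW DM DW] by blast
    have "lorentz D R = 0" using DP DM DU by (simp add: R_def lorentz_simps)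
    then have "lorentz R R = 0" by (simp add: c lorentz_simps)
    then have "R = 0" using lorentz_spacelike(2)[OF RM] by simp
    then have P: "?P = A *\<^sub>R ?M + B *\<^sub>R U" by (simp add: R_def algebra_simps)
    have "1 = lorentz ?P ?P" by (simp add: lorentz_Rep_self)
    also have "\<dots> = A * A - B * B"
      using q(3,4) by (simp add: P lorentz_simps lorentz_Rep_self lorentz_commute[of U ?M])
    finally have "(cosh (arsinh B))\<^sup>2 = A\<^sup>2"
      using cosh_square_eq[of "arsinh B"] by (simp add: power2_eq_square)
    moreover have "A \<ge> 1" unfolding A_def by (rule lorentz_ge_1)
    ultimately have "cosh (arsinh B) = A"
      by (metis cosh_real_nonneg order_trans power2_eq_imp_eq zero_le_one)
    then have "Rep_hyp_plane (q (arsinh B)) = ?P" by (simp add: q P)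
    then show "p \<in> range q" by (metis Rep_hyp_plane_inject rangeI)
  qed (use q m in auto)
qed

section \<open>Topology of the hyperbolic plane\<close>

text \<open>The hyperboloid as a graph over its spatial coordinates: a global chart that carries the
  topology of R^2 over to the plane.\<close>

definition hyp_of :: "real^2 \<Rightarrow> hyp_plane" where
  "hyp_of z = Abs_hyp_plane (z, sqrt (1 + (norm z)\<^sup>2))"

lemma Rep_hyp_of: "Rep_hyp_plane (hyp_of z) = (z, sqrt (1 + (norm z)\<^sup>2))"
  unfolding hyp_of_def
proof (rule Abs_hyp_plane_inverse)
  have "0 < 1 + (norm z)\<^sup>2" by (smt (verit) zero_le_power2)
  then show "(z, sqrt (1 + (norm z)\<^sup>2)) \<in> {p. 0 < snd p \<and> (snd p)\<^sup>2 = 1 + (norm (fst p))\<^sup>2}" by simp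
qed

lemma hyp_of_fst_Rep: "hyp_of (fst (Rep_hyp_plane p)) = p"
proof -
  have "0 < snd (Rep_hyp_plane p)" "(snd (Rep_hyp_plane p))\<^sup>2 = 1 + (norm (fst (Rep_hyp_plane p)))\<^sup>2"
    using Rep_hyp_plane[of p] by auto
  then have "sqrt (1 + (norm (fst (Rep_hyp_plane p)))\<^sup>2) = snd (Rep_hyp_plane p)"
    by (metis less_imp_le real_sqrt_unique)
  then have "Rep_hyp_plane (hyp_of (fst (Rep_hyp_plane p))) = Rep_hyp_plane p"
    by (simp add: Rep_hyp_of)
  then show ?thesis by (simp add: Rep_hyp_plane_inject)
qed

lemma continuous_on_hyp_of: "continuous_on A hyp_of"
proof -
  have "(hyp_of \<longlongrightarrow> hyp_of z0) (at z0)" for z0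
  proof -
    have "continuous_on UNIV (\<lambda>z. dist (hyp_of z) (hyp_of z0))"
      unfolding dist_hyp_plane_def
    proof (rule continuous_on_compose2[OF continuous_on_arcosh[OF order.refl]])
      show "continuous_on UNIV (\<lambda>z. lorentz (Rep_hyp_plane (hyp_of z)) (Rep_hyp_plane (hyp_of z0)))"
        unfolding Rep_hyp_of lorentz_def by (intro continuous_intros)
    qed (auto simp: lorentz_ge_1)
    then have "((\<lambda>z. dist (hyp_of z) (hyp_of z0)) \<longlongrightarrow> dist (hyp_of z0) (hyp_of z0)) (at z0)"
      by (metis UNIV_I continuous_on_def)
    then show ?thesis by (simp add: tendsto_dist_iff[of hyp_of])
  qed
  then show ?thesis by (simp add: continuous_at_imp_continuous_on isCont_def)
qed

lemma continuous_on_fst_Rep: "continuous_on A (\<lambda>p. fst (Rep_hyp_plane p))"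
proof -
  have "((\<lambda>p. fst (Rep_hyp_plane p)) \<longlongrightarrow> fst (Rep_hyp_plane p0)) (at p0)" for p0
  proof -
    let ?f = "\<lambda>p. norm (fst (Rep_hyp_plane p) - fst (Rep_hyp_plane p0))"
    \<comment> \<open>Expanding the form on the difference of two points expresses the Euclidean
      distance of their spatial parts by hyperbolic distances alone; the time coordinate is cosh of
      the distance to \<open>hyp_of 0\<close>.\<close>
    define g where "g = (\<lambda>p. sqrt ((cosh (dist p (hyp_of 0)) - cosh (dist p0 (hyp_of 0)))\<^sup>2
                                  + 2 * (cosh (dist p p0) - 1)))"
    have "?f p = g p" for p
    proof -
      have "(?f p)\<^sup>2 = (cosh (dist p (hyp_of 0)) - cosh (dist p0 (hyp_of 0)))\<^sup>2 + 2 * (cosh (dist p p0) - 1)"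
        unfolding cosh_dist
        unfolding power2_norm_eq_inner
        by (simp add: Rep_hyp_of lorentz_def inner_diff_left inner_diff_right
             Rep_hyp_plane_inner inner_commute algebra_simps power2_eq_square)
      then show ?thesis unfolding g_def by (metis norm_ge_zero real_sqrt_unique)
    qed
    moreover have "continuous_on UNIV g" unfolding g_def cosh_field_def by (intro continuous_intros) auto
    then have "(g \<longlongrightarrow> g p0) (at p0)" by (metis UNIV_I continuous_on_def)
    ultimately have "(?f \<longlongrightarrow> 0) (at p0)" by (simp add: g_def)
    then show ?thesis by (rule LIM_zero_cancel[OF tendsto_norm_zero_cancel])
  qed
  then show ?thesis by (simp add: continuous_at_imp_continuous_on isCont_def)
qed

lemma homeomorphism_hyp_of: "homeomorphism UNIV UNIV hyp_of (\<lambda>p. fst (Rep_hyp_plane p))"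
  by (rule homeomorphismI) (auto simp: hyp_of_fst_Rep Rep_hyp_of continuous_on_hyp_of continuous_on_fst_Rep)

lemma compact_hyp_plane:
  fixes A :: "hyp_plane set"
  assumes "bounded A" "closed A"
  shows "compact A"
proof -
  obtain r where r: "\<And>p. p \<in> A \<Longrightarrow> dist (hyp_of 0) p \<le> r"
    using assms(1) bounded_any_center[of A "hyp_of 0"] by auto
  have "A \<subseteq> hyp_of ` cball 0 (cosh r)"
  proof
    fix p assume "p \<in> A"
    define t where "t = snd (Rep_hyp_plane p)"
    have t: "0 < t" "t\<^sup>2 = 1 + (norm (fst (Rep_hyp_plane p)))\<^sup>2"
      using Rep_hyp_plane[of p] by (auto simp: t_def)
    have "cosh (dist (hyp_of 0) p) \<le> cosh r"
      using r[OF \<open>p \<in> A\<close>] by (meson cosh_real_nonneg_le_iff order_trans zero_le_dist)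
    then have "t \<le> cosh r" by (simp add: cosh_dist Rep_hyp_of lorentz_def t_def)
    moreover have "norm (fst (Rep_hyp_plane p)) \<le> t"
      using t by (smt (verit) power2_le_imp_le)
    ultimately have "fst (Rep_hyp_plane p) \<in> cball 0 (cosh r)" by simp
    then show "p \<in> hyp_of ` cball 0 (cosh r)" using hyp_of_fst_Rep by (metis imageI)
  qed
  moreover have "compact (hyp_of ` cball 0 (cosh r))"
    by (intro compact_continuous_image continuous_on_hyp_of compact_cball)
  ultimately show ?thesis
    using assms(2) by (metis compact_Int_closed inf.absorb_iff2)
qed

lemma finite_discrete_Int_cball:
  fixes S :: "hyp_plane set"
  assumes "closed S" "discrete S"
  shows "finite (S \<inter> cball p r)"
proof -
  have "compact (cball p r)" by (simp add: compact_hyp_plane)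
  moreover have "\<not> z islimpt S" for z
    using assms by (metis closed_limpt discreteD isolated_in_islimpt_iff)
  ultimately show ?thesis using finite_not_islimpt_in_compact by (metis Int_commute)
qed

section \<open>Non-centered edges\<close>

text \<open>Cells are replaced by one function, the height \<open>infdist _ S\<close>: membership
  means that the site realises it.\<close>

lemma vor_cell_iff_infdist:
  assumes "x \<in> S"
  shows "p \<in> vor_cell S x \<longleftrightarrow> dist p x = infdist p S"
proof
  assume "p \<in> vor_cell S x"
  then have "dist p x \<le> dist p y" if "y \<in> S" for y
    using that by (cases "y = x") (auto simp: vor_cell_def)
  moreover have "S \<noteq> {}" using assms by blast
  ultimately have "dist p x \<le> infdist p S" by (auto simp: infdist_notempty intro: cINF_greatest)
  then show "dist p x = infdist p S" using infdist_le[OF assms, of p] by linarith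
next
  assume "dist p x = infdist p S"
  then show "p \<in> vor_cell S x" by (auto simp: vor_cell_def infdist_le)
qed

lemma closed_vor_cell: "closed (vor_cell S x)"
proof -
  have "vor_cell S x = (\<Inter>y\<in>S - {x}. {p. dist p x \<le> dist p y})" by (auto simp: vor_cell_def)
  then show ?thesis by (auto intro!: closed_Collect_le continuous_intros)
qed

section \<open>Half-planes along a geodesic\<close>

lemma geodesic_line_lorentz_convex:
  assumes q: "\<And>t. Rep_hyp_plane (q t) = cosh t *\<^sub>R P + sinh t *\<^sub>R U"
  shows "sinh (b - a) * lorentz (Rep_hyp_plane (q t)) D
       = sinh (b - t) * lorentz (Rep_hyp_plane (q a)) D + sinh (t - a) * lorentz (Rep_hyp_plane (q b)) D"
proof -
  have "lorentz (sinh (b - a) *\<^sub>R Rep_hyp_plane (q t)) D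
      = lorentz (sinh (b - t) *\<^sub>R Rep_hyp_plane (q a) + sinh (t - a) *\<^sub>R Rep_hyp_plane (q b)) D"
    unfolding geodesic_line_convex[OF q, of b a t] ..
  then show ?thesis unfolding lorentz_simps .
qed

lemma geodesic_line_closer_convex:
  assumes q: "\<And>t. Rep_hyp_plane (q t) = cosh t *\<^sub>R P + sinh t *\<^sub>R U"
    and "dist (q a) x \<le> dist (q a) y" "dist (q b) x \<le> dist (q b) y" "a \<le> t" "t \<le> b"
  shows "dist (q t) x \<le> dist (q t) y"
proof (cases "a = b")
  case False
  then have "a < b" using assms by simp
  define D where "D = Rep_hyp_plane y - Rep_hyp_plane x"
  have D: "0 \<le> lorentz (Rep_hyp_plane (q s)) D \<longleftrightarrow> dist (q s) x \<le> dist (q s) y" for s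
    by (simp add: D_def dist_le_iff_lorentz lorentz_simps)
  have "0 \<le> sinh (b - a) * lorentz (Rep_hyp_plane (q t)) D"
    using assms unfolding geodesic_line_lorentz_convex[OF q, of b a t D] D[symmetric]
    by (intro add_nonneg_nonneg mult_nonneg_nonneg) simp_all
  then show ?thesis using \<open>a < b\<close> by (simp add: zero_le_mult_iff flip: D)
qed (use assms in auto)

text \<open>A linear functional that is nonnegative at both ends and zero strictly between is a sum
  of two nonnegative terms equal to zero, so it vanishes at both ends.\<close>

lemma geodesic_line_equidistant_ends:
  assumes q: "\<And>t. Rep_hyp_plane (q t) = cosh t *\<^sub>R P + sinh t *\<^sub>R U"
    and "dist (q a) x \<le> dist (q a) y" "dist (q b) x \<le> dist (q b) y" "a < t" "t < b"
    and "dist (q t) x = dist (q t) y"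
  shows "dist (q a) x = dist (q a) y" "dist (q b) x = dist (q b) y"
proof -
  define D where "D = Rep_hyp_plane y - Rep_hyp_plane x"
  have D: "0 \<le> lorentz (Rep_hyp_plane (q s)) D \<longleftrightarrow> dist (q s) x \<le> dist (q s) y"
    "lorentz (Rep_hyp_plane (q s)) D = 0 \<longleftrightarrow> dist (q s) x = dist (q s) y" for s
    by (auto simp add: D_def dist_le_iff_lorentz dist_eq_iff_lorentz lorentz_simps)
  have "0 = sinh (b - t) * lorentz (Rep_hyp_plane (q a)) D + sinh (t - a) * lorentz (Rep_hyp_plane (q b)) D"
    using geodesic_line_lorentz_convex[OF q, of b a t D] assms(6) D(2)[of t] by simp
  moreover have "0 \<le> sinh (b - t) * lorentz (Rep_hyp_plane (q a)) D"
    "0 \<le> sinh (t - a) * lorentz (Rep_hyp_plane (q b)) D"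
    using assms(2-5) D(1) by (simp_all add: mult_nonneg_nonneg)
  ultimately have "sinh (b - t) * lorentz (Rep_hyp_plane (q a)) D = 0"
    "sinh (t - a) * lorentz (Rep_hyp_plane (q b)) D = 0" by linarith+
  then show "dist (q a) x = dist (q a) y" "dist (q b) x = dist (q b) y"
    using assms(4,5) D(2) by auto
qed

text \<open>
  The bisector of \<open>x\<close> and \<open>y\<close> is parametrised by arc length from their midpoint \<open>q 0\<close>, with the edge
  on the side of the nonnegative parameters.
\<close>

locale noncentered_edge_line =
  fixes S e :: "hyp_plane set" and x y :: hyp_plane and q :: "real \<Rightarrow> hyp_plane"
    and U :: "(real^2) \<times> real" and k c :: real
  assumes sites: "x \<in> S" "y \<in> S" "x \<noteq> y"
    and e_eq: "e = vor_cell S x \<inter> vor_cell S y"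
    and k_pos: "0 < k" and Rep_q_0: "Rep_hyp_plane (q 0) = k *\<^sub>R (Rep_hyp_plane x + Rep_hyp_plane y)"
    and Rep_q: "\<And>t. Rep_hyp_plane (q t) = cosh t *\<^sub>R Rep_hyp_plane (q 0) + sinh t *\<^sub>R U"
    and dist_q: "\<And>r s. dist (q r) (q s) = \<bar>r - s\<bar>"
    and c_pos: "0 < c" and cosh_dist_q: "\<And>t. cosh (dist (q t) x) = c * cosh t"
    and equidistant: "\<And>t. dist (q t) x = dist (q t) y"
    and e_range: "e \<subseteq> range q"
    and nonneg: "\<And>t. q t \<in> e \<Longrightarrow> 0 \<le> t"
    and nondegenerate: "\<exists>a b. a < b \<and> q a \<in> e \<and> q b \<in> e"

text \<open>The midpoint of the sites may still be an endpoint of \<open>e\<close>; being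
  non-centered only keeps it out of the interior, which is why the parameters satisfy
  \<open>0 <= t\<close> and not \<open>0 < t\<close>.\<close>

lemma noncentered_edge_line_exists:
  assumes "e \<in> noncentered_edges S"
  shows "\<exists>x y q U k c. noncentered_edge_line S e x y q U k c"
proof -
  have "e \<in> vor_edges S" and nc: "\<not> centered_edge S e"
    using assms by (auto simp: noncentered_edges_def)
  then obtain x y p1 p2 where xy: "x \<in> S" "y \<in> S" "x \<noteq> y" and e: "e = vor_cell S x \<inter> vor_cell S y"
    and p: "p1 \<in> e" "p2 \<in> e" "p1 \<noteq> p2"
    unfolding vor_edges_def by blast
  have eqd: "dist p x = dist p y" if "p \<in> e" for p
    using that xy by (simp add: e vor_cell_iff_infdist)
  obtain q U c k where q: "0 < k"
    "Rep_hyp_plane (q 0) = k *\<^sub>R (Rep_hyp_plane x + Rep_hyp_plane y)" "q 0 \<in> geodesic_arc x y"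
    "\<And>t. Rep_hyp_plane (q t) = cosh t *\<^sub>R Rep_hyp_plane (q 0) + sinh t *\<^sub>R U"
    "\<And>r s. dist (q r) (q s) = \<bar>r - s\<bar>"
    "0 < c" "\<And>t. cosh (dist (q t) x) = c * cosh t" "\<And>t. dist (q t) x = dist (q t) y"
    "\<And>p. dist p x = dist p y \<Longrightarrow> p \<in> range q"
    by (rule bisector_line[OF xy(3) p(3) eqd[OF p(1)] eqd[OF p(2)]], rule that, assumption+)
  have range: "e \<subseteq> range q" using q(9) eqd by blast
  \<comment> \<open>With parameters of both signs the midpoint \<open>q 0\<close> lies inside
    \<open>e\<close> by convexity of the cells, and it lies on the dual arc: the edge would be
    centered.\<close>
  have one_sided: "False" if "a < 0" "0 < b" "q a \<in> e" "q b \<in> e" for a b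
  proof -
    have ne: "q a \<noteq> q 0" "q b \<noteq> q 0" using q(5)[of a 0] q(5)[of b 0] that by auto
    have "q 0 \<in> vor_cell S x"
      using that geodesic_line_closer_convex[OF q(4), of a x _ b 0] by (auto simp: e vor_cell_def)
    moreover have "q 0 \<in> vor_cell S y"
      using that geodesic_line_closer_convex[OF q(4), of a y _ b 0] by (auto simp: e vor_cell_def)
    moreover have "q 0 \<in> geodesic_arc (q a) (q b)"
      using in_geodesic_arc[OF q(5)] that by auto
    ultimately have "q 0 \<in> edge_interior e" using ne that by (auto simp: edge_interior_def e)
    then have "centered_edge S e" unfolding centered_edge_def using xy e q(3) \<open>e \<in> vor_edges S\<close> by blast
    with nc show False by blast
  qed
  obtain t1 t2 where t: "p1 = q t1" "p2 = q t2" using range p by blast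
  show ?thesis
  proof (cases "\<forall>t. q t \<in> e \<longrightarrow> 0 \<le> t")
    case True
    have "noncentered_edge_line S e x y q U k c"
    proof
      show "\<exists>a b. a < b \<and> q a \<in> e \<and> q b \<in> e" using p t by (metis linorder_neqE)
      show "cosh (dist (q t) x) = c * cosh t" "dist (q t) x = dist (q t) y" for t by (rule q(7,8))+
    qed (fact q xy e range | use True in blast)+
    then show ?thesis by blast
  next
    case False
    then have neg: "t \<le> 0" if "q t \<in> e" for t using one_sided that by (meson not_le)
    \<comment> \<open>The edge lies on the negative side, so the bisector is traversed
      backwards.\<close>
    have "noncentered_edge_line S e x y (\<lambda>t. q (- t)) (- U) k c"
    proof
      show "\<exists>a b. a < b \<and> q (- a) \<in> e \<and> q (- b) \<in> e"
        using p t by (metis linorder_neqE minus_minus)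
      show "Rep_hyp_plane (q (- t)) = cosh t *\<^sub>R Rep_hyp_plane (q (- 0)) + sinh t *\<^sub>R - U" for t
        using q(4)[of "- t"] by simp
      show "e \<subseteq> range (\<lambda>t. q (- t))"
      proof
        fix p assume "p \<in> e"
        then obtain t where "p = q t" using range by blast
        then show "p \<in> range (\<lambda>t. q (- t))" by (intro range_eqI[of _ _ "- t"]) simp
      qed
      show "0 \<le> t" if "q (- t) \<in> e" for t using neg[OF that] by simp
      show "cosh (dist (q (- t)) x) = c * cosh t" for t using q(7)[of "- t"] by simp
      show "dist (q (- t)) x = dist (q (- t)) y" for t by (rule q(8))
      show "Rep_hyp_plane (q (- 0)) = k *\<^sub>R (Rep_hyp_plane x + Rep_hyp_plane y)" using q(2) by simp
    qed (simp_all add: q(1,5,6) xy e)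
    then show ?thesis by blast
  qed
qed

section \<open>A single non-centered edge in its arc-length parameter\<close>

context noncentered_edge_line
begin

lemma in_e_iff: "q t \<in> e \<longleftrightarrow> infdist (q t) S = dist (q t) x"
  using sites equidistant[of t] by (auto simp: e_eq vor_cell_iff_infdist)

lemma cosh_infdist: "q t \<in> e \<Longrightarrow> cosh (infdist (q t) S) = c * cosh t"
  using cosh_dist_q[of t] in_e_iff[of t] by simp

lemma param: "p \<in> e \<Longrightarrow> \<exists>t\<ge>0. p = q t"
  using e_range nonneg by blast

lemma q_inj: "q s = q t \<longleftrightarrow> s = t"
  using dist_q[of s t] by auto

text \<open>On \<open>e\<close> cosh of the height is \<open>c * cosh t\<close>, which increases for
  \<open>0 <= t\<close>; this is what one-sidedness is for.\<close>

lemma infdist_less_iff: "q s \<in> e \<Longrightarrow> q t \<in> e \<Longrightarrow> infdist (q s) S < infdist (q t) S \<longleftrightarrow> s < t"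
  using cosh_real_nonneg_less_iff[of "infdist (q s) S" "infdist (q t) S"]
    cosh_real_nonneg_less_iff[of s t] c_pos nonneg
  by (simp add: cosh_infdist infdist_nonneg)

lemma between:
  assumes "q a \<in> e" "q b \<in> e" "a \<le> t" "t \<le> b"
  shows "q t \<in> e"
  using assms geodesic_line_closer_convex[OF Rep_q, of a _ _ b t] by (auto simp: e_eq vor_cell_def)

lemma closed_e: "closed e" by (simp add: e_eq closed_vor_cell closed_Int)

lemma continuous_on_q: "continuous_on A q"
  unfolding continuous_on_iff dist_q dist_real_def by blast

lemma e_eq_image: "e = q ` {t. q t \<in> e}"
  using e_range by blast

lemma connected_e: "connected e"
proof -
  have "is_interval {t. q t \<in> e}"
    unfolding is_interval_1 using between by blast
  then have "connected (q ` {t. q t \<in> e})"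
    by (intro connected_continuous_image continuous_on_q) (simp add: is_interval_connected_1)
  then show ?thesis using e_eq_image by simp
qed

lemma closed_params: "closed {t. q t \<in> e}"
  using closed_vimage[OF closed_e continuous_on_q] by (simp add: vimage_def)

lemma other_site_at_vertex:
  assumes "q t \<in> e" "q t \<in> vor_vertices S"
  obtains z where "z \<in> S" "z \<noteq> x" "z \<noteq> y" "dist (q t) z = dist (q t) x"
proof -
  obtain z where "z \<in> S" "z \<noteq> x" "z \<noteq> y" "q t \<in> vor_cell S z"
    using assms(2) unfolding vor_vertices_def by blast
  moreover then have "dist (q t) z = dist (q t) x"
    using assms(1) in_e_iff vor_cell_iff_infdist by metis
  ultimately show thesis using that by blast
qed

text \<open>A third closest site at an interior point of the edge is forced to be equidistant at
  both \<open>q a\<close> and \<open>q b\<close>, so it would lie with \<open>x\<close> and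
  \<open>y\<close> on two circles with different centres.\<close>

lemma interior_not_vertex:
  assumes "q a \<in> e" "q b \<in> e" "a < t" "t < b"
  shows "q t \<notin> vor_vertices S"
proof
  assume v: "q t \<in> vor_vertices S"
  have "q t \<in> e" using between[OF assms(1,2)] assms(3,4) by simp
  from other_site_at_vertex[OF this v] obtain z
    where z: "z \<in> S" "z \<noteq> x" "z \<noteq> y" "dist (q t) z = dist (q t) x" .
  have le: "dist (q a) x \<le> dist (q a) z" "dist (q b) x \<le> dist (q b) z"
    using assms(1,2) z in_e_iff infdist_le by metis+
  have "dist (q a) x = dist (q a) z" "dist (q b) x = dist (q b) z"
    using geodesic_line_equidistant_ends[OF Rep_q le assms(3,4)] z(4) by simp_all
  moreover have "q a \<noteq> q b" using assms(3,4) by (simp add: q_inj)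
  ultimately have "z = x \<or> z = y"
    using circles_meet_at_most_twice[OF _ sites(3)] equidistant by metis
  with z show False by blast
qed

text \<open>At a non-vertex only \<open>x\<close> and \<open>y\<close> are closest, and by
  discreteness all other sites are farther by a uniform gap. So an endpoint of an edge must be a
  vertex.\<close>

lemma extends_beyond_non_vertex:
  assumes S: "closed S" "discrete S" and t: "q t \<in> e" "q t \<notin> vor_vertices S"
  obtains d where "0 < d" "\<And>s. \<bar>s - t\<bar> < d \<Longrightarrow> q s \<in> e"
proof -
  define r where "r = dist (q t) x"
  define F where "F = (S \<inter> cball (q t) (r + 1)) - {x, y}"
  have fin: "finite F" unfolding F_def by (simp add: finite_discrete_Int_cball[OF S])
  have pos: "r < dist (q t) z" if "z \<in> S - {x, y}" for z
  proof -
    have "r \<le> dist (q t) z" using t(1) that in_e_iff infdist_le r_def by (metis DiffD1)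
    moreover have "r \<noteq> dist (q t) z"
    proof
      assume "r = dist (q t) z"
      then have "q t \<in> vor_cell S z"
        using t(1) that in_e_iff vor_cell_iff_infdist r_def by (metis DiffD1)
      then have "q t \<in> vor_vertices S"
        using t(1) that sites unfolding vor_vertices_def e_eq by blast
      with t(2) show False by blast
    qed
    ultimately show ?thesis by linarith
  qed
  \<comment> \<open>The gap over the finitely many nearby sites. The entry 1 bounds the gap for
    sites outside the ball of radius \<open>r + 1\<close> and covers an empty
    \<open>F\<close>.\<close>
  define d where "d = Min (insert 1 ((\<lambda>z. dist (q t) z - r) ` F))"
  have d: "0 < d" "d \<le> 1" using fin pos by (auto simp: d_def F_def)
  have far: "r + d \<le> dist (q t) z" if z: "z \<in> S - {x, y}" for z
  proof (cases "z \<in> F")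
    case True
    then have "d \<le> dist (q t) z - r" unfolding d_def using fin by (intro Min_le) auto
    then show ?thesis by simp
  next
    case False
    then have "r + 1 < dist (q t) z" using z by (auto simp: F_def)
    then show ?thesis using d by simp
  qed
  show thesis
  \<comment> \<open>Moving by less than half the gap changes each of the two compared distances by
    less than \<open>d / 2\<close>.\<close>
  proof (rule that[of "d / 2"])
    show "q s \<in> e" if s: "\<bar>s - t\<bar> < d / 2" for s
    proof -
      have "dist (q s) x \<le> dist (q s) z" if "z \<in> S" for z
      proof (cases "z = x \<or> z = y")
        case True then show ?thesis using equidistant[of s] by auto
      next
        case False
        have "dist (q s) x \<le> r + d / 2"
          using dist_triangle[of "q s" x "q t"] dist_q[of s t] s by (simp add: r_def)
        moreover have "dist (q t) z \<le> dist (q s) z + d / 2"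
          using dist_triangle[of "q t" z "q s"] dist_q[of t s] s
            by (simp add: abs_minus_commute[of t s])
        ultimately show ?thesis using far[of z] False that by simp
      qed
      then show ?thesis using equidistant[of s] by (simp add: e_eq vor_cell_def)
    qed
  qed (use d in simp)
qed

text \<open>The midpoint bounds the parameters below, so even a ray has this end.\<close>

lemma least_param:
  assumes "closed S" "discrete S"
  obtains a where "q a \<in> e" "q a \<in> vor_vertices S" "\<And>t. q t \<in> e \<Longrightarrow> a \<le> t"
proof -
  let ?I = "{t. q t \<in> e}"
  have bdd: "bdd_below ?I" using nonneg by (intro bdd_belowI[of _ 0]) simp
  have ne: "?I \<noteq> {}" using nondegenerate by blast
  define a where "a = Inf ?I"
  have a: "q a \<in> e" using closed_contains_Inf[OF ne bdd closed_params] by (simp add: a_def)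
  have low: "a \<le> t" if "q t \<in> e" for t
    unfolding a_def using bdd that by (intro cInf_lower) auto
  have "q a \<in> vor_vertices S"
  proof (rule ccontr)
    assume "q a \<notin> vor_vertices S"
    then obtain d where d: "0 < d" "\<And>s. \<bar>s - a\<bar> < d \<Longrightarrow> q s \<in> e"
      using extends_beyond_non_vertex[OF assms a] by blast
    have "q (a - d / 2) \<in> e" using d by (intro d(2)) simp
    from low[OF this] d(1) show False by simp
  qed
  with a low that show thesis by blast
qed

lemma greatest_param:
  assumes "closed S" "discrete S" and bdd: "\<And>p. p \<in> e \<Longrightarrow> infdist p S \<le> R"
  obtains b where "q b \<in> e" "q b \<in> vor_vertices S" "\<And>t. q t \<in> e \<Longrightarrow> t \<le> b"
proof -
  let ?I = "{t. q t \<in> e}"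
  obtain a where a: "q a \<in> e" using nondegenerate by blast
  \<comment> \<open>Two points of the edge are both within \<open>R\<close> of \<open>x\<close>; a
    bounded height thus rules out rays.\<close>
  have "t \<le> a + 2 * R" if "q t \<in> e" for t
  proof -
    have "dist (q t) x \<le> R" "dist (q a) x \<le> R"
      using bdd[OF that] bdd[OF a] that a in_e_iff by simp_all
    then show ?thesis
      using dist_triangle2[of "q t" "q a" x] dist_q[of t a] by (simp add: abs_le_iff)
  qed
  then have bdd: "bdd_above ?I" by (intro bdd_aboveI[of _ "a + 2 * R"]) simp
  have ne: "?I \<noteq> {}" using a by blast
  define b where "b = Sup ?I"
  have b: "q b \<in> e" using closed_contains_Sup[OF ne bdd closed_params] by (simp add: b_def)
  have up: "t \<le> b" if "q t \<in> e" for t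
    unfolding b_def using bdd that by (intro cSup_upper) auto
  have "q b \<in> vor_vertices S"
  proof (rule ccontr)
    assume "q b \<notin> vor_vertices S"
    then obtain d where d: "0 < d" "\<And>s. \<bar>s - b\<bar> < d \<Longrightarrow> q s \<in> e"
      using extends_beyond_non_vertex[OF assms(1,2) b] by blast
    have "q (b + d / 2) \<in> e" using d by (intro d(2)) simp
    from up[OF this] d(1) show False by simp
  qed
  with b up that show thesis by blast
qed

text \<open>The disc claim. The functional \<open>lorentz _ (z - x)\<close> is zero at
  \<open>q a\<close> and nonnegative at the higher point \<open>q b\<close>, hence nonpositive at
  the midpoint \<open>q 0\<close>, on the other side of \<open>q a\<close>.\<close>

lemma sites_near_lower_end:
  assumes "q a \<in> e" "q b \<in> e" "a < b" "z \<in> S" "q a \<in> vor_cell S z"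
  shows "lorentz (Rep_hyp_plane x + Rep_hyp_plane y) (Rep_hyp_plane z)
       \<le> lorentz (Rep_hyp_plane x + Rep_hyp_plane y) (Rep_hyp_plane x)"
proof -
  define D where "D = Rep_hyp_plane z - Rep_hyp_plane x"
  have a: "0 \<le> a" using nonneg assms(1) by blast
  have "dist (q a) z = dist (q a) x"
    using assms in_e_iff vor_cell_iff_infdist by metis
  then have "lorentz (Rep_hyp_plane (q a)) D = 0"
    by (simp add: D_def lorentz_simps dist_eq_iff_lorentz)
  then have "sinh (b - a) * lorentz (Rep_hyp_plane (q 0)) D + sinh a * lorentz (Rep_hyp_plane (q b)) D = 0"
    using geodesic_line_lorentz_convex[OF Rep_q, of b 0 a D] by simp
  moreover have "dist (q b) x \<le> dist (q b) z"
    using assms in_e_iff infdist_le by metis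
  then have "0 \<le> lorentz (Rep_hyp_plane (q b)) D"
    by (simp add: D_def lorentz_simps dist_le_iff_lorentz)
  then have "0 \<le> sinh a * lorentz (Rep_hyp_plane (q b)) D" using a by simp
  ultimately have "sinh (b - a) * lorentz (Rep_hyp_plane (q 0)) D \<le> 0" by linarith
  then have "lorentz (Rep_hyp_plane (q 0)) D \<le> 0" using assms(3) by (simp add: mult_le_0_iff)
  then show ?thesis using k_pos by (simp add: D_def Rep_q_0 lorentz_simps mult_le_0_iff)
qed

end

lemma ascending_edge_unique:
  assumes e: "e \<in> noncentered_edges S" and e': "e' \<in> noncentered_edges S"
    and v: "v \<in> e" "v \<in> e'" and w: "w \<in> e" "infdist v S < infdist w S"
    and w': "w' \<in> e'" "infdist v S < infdist w' S"
  shows "e = e'"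
proof -
  obtain x y q U k c where "noncentered_edge_line S e x y q U k c"
    using noncentered_edge_line_exists[OF e] by blast
  then interpret l: noncentered_edge_line S e x y q U k c .
  obtain x' y' q' U' k' c' where "noncentered_edge_line S e' x' y' q' U' k' c'"
    using noncentered_edge_line_exists[OF e'] by blast
  then interpret l': noncentered_edge_line S e' x' y' q' U' k' c' .
  let ?s = "Rep_hyp_plane x + Rep_hyp_plane y" and ?s' = "Rep_hyp_plane x' + Rep_hyp_plane y'"
  have cells: "v \<in> vor_cell S x" "v \<in> vor_cell S y" "v \<in> vor_cell S x'" "v \<in> vor_cell S y'"
    using v by (simp_all add: l.e_eq l'.e_eq)
  obtain a b where ab: "v = q a" "w = q b" using l.param v w by blast
  obtain a' b' where ab': "v = q' a'" "w' = q' b'" using l'.param v w' by blast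
  have lt: "a < b" using w v l.infdist_less_iff by (simp add: ab)
  have lt': "a' < b'" using w' v l'.infdist_less_iff by (simp add: ab')
  have "lorentz ?s (Rep_hyp_plane x') \<le> lorentz ?s (Rep_hyp_plane x)"
    "lorentz ?s (Rep_hyp_plane y') \<le> lorentz ?s (Rep_hyp_plane x)"
    using l.sites_near_lower_end[OF _ _ lt] v w cells l'.sites by (simp_all add: ab)
  \<comment> \<open>The two bounds add up, and \<open>lorentz ?s ?s\<close> is twice the product of
    \<open>?s\<close> with either of its own sites.\<close>
  then have 1: "lorentz ?s ?s' \<le> lorentz ?s ?s"
    by (simp add: lorentz_simps lorentz_Rep_self lorentz_commute[of "Rep_hyp_plane y" "Rep_hyp_plane x"])
  have "lorentz ?s' (Rep_hyp_plane x) \<le> lorentz ?s' (Rep_hyp_plane x')"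
    "lorentz ?s' (Rep_hyp_plane y) \<le> lorentz ?s' (Rep_hyp_plane x')"
    using l'.sites_near_lower_end[OF _ _ lt'] v w' cells l.sites by (simp_all add: ab')
  then have 2: "lorentz ?s ?s' \<le> lorentz ?s' ?s'"
    unfolding lorentz_commute[of ?s ?s']
    by (simp add: lorentz_simps lorentz_Rep_self lorentz_commute[of "Rep_hyp_plane y'" "Rep_hyp_plane x'"])
  have s: "?s = ?s'" using sum_eq_if_lorentz_le[OF 1 2] .
  \<comment> \<open>Equal sums still allow two different diameters of one disc. At \<open>w\<close>
    the sites \<open>x\<close>, \<open>y\<close> are closest and the products of \<open>w\<close>
    with both pairs have the same sum, so all four sites are equally far from \<open>w\<close>, as
    they are from \<open>v\<close>.\<close>
  have wd: "dist w x = infdist w S" "dist w y = infdist w S"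
    using w l.sites by (simp_all add: l.e_eq vor_cell_iff_infdist)
  have "dist w x \<le> dist w x'" "dist w x \<le> dist w y'"
    using wd infdist_le l'.sites by simp_all
  moreover have "lorentz (Rep_hyp_plane w) (Rep_hyp_plane x) + lorentz (Rep_hyp_plane w) (Rep_hyp_plane y)
      = lorentz (Rep_hyp_plane w) (Rep_hyp_plane x') + lorentz (Rep_hyp_plane w) (Rep_hyp_plane y')"
    using s by (metis lorentz_simps(2))
  moreover have "dist w x = dist w y" using wd by simp
  ultimately have w_eq: "dist w x = dist w x'" "dist w x = dist w y'"
    unfolding dist_le_iff_lorentz dist_eq_iff_lorentz by linarith+
  have v_eq: "dist v x = dist v y" "dist v x = dist v x'" "dist v x = dist v y'"
    using cells l.sites l'.sites by (simp_all add: vor_cell_iff_infdist)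
  have "v \<noteq> w" using w by blast
  note two = circles_meet_at_most_twice[OF this l.sites(3) v_eq(1) _ \<open>dist w x = dist w y\<close>]
  have "x' = x \<or> x' = y" "y' = x \<or> y' = y"
    using two v_eq w_eq by blast+
  then show ?thesis using l'.sites(3) by (auto simp: l.e_eq l'.e_eq)
qed

lemma infdist_neq_on_edge:
  assumes "e \<in> noncentered_edges S" "v \<in> e" "w \<in> e" "v \<noteq> w"
  shows "infdist v S \<noteq> infdist w S"
proof -
  obtain x y q U k c where "noncentered_edge_line S e x y q U k c"
    using noncentered_edge_line_exists[OF assms(1)] by blast
  then interpret l: noncentered_edge_line S e x y q U k c .
  obtain a b where "v = q a" "w = q b" using l.param assms by blast
  with assms show ?thesis using l.infdist_less_iff by (metis less_irrefl linorder_neqE)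
qed

text \<open>Different edges have different pairs of sites, so a common point has a third closest
  site.\<close>

lemma vor_edges_Int_vertex:
  assumes "e \<in> vor_edges S" "f \<in> vor_edges S" "e \<noteq> f" "p \<in> e" "p \<in> f"
  shows "p \<in> vor_vertices S"
proof -
  obtain x y where x: "x \<in> S" "y \<in> S" "x \<noteq> y" "e = vor_cell S x \<inter> vor_cell S y"
    using assms(1) unfolding vor_edges_def by blast
  obtain x' y' where x': "x' \<in> S" "y' \<in> S" "x' \<noteq> y'" "f = vor_cell S x' \<inter> vor_cell S y'"
    using assms(2) unfolding vor_edges_def by blast
  have "\<not> {x', y'} \<subseteq> {x, y}" using x x' assms(3) by auto
  then obtain z where "z \<in> {x', y'}" "z \<noteq> x" "z \<noteq> y" by blast
  moreover from this(1) have "z \<in> S" "p \<in> vor_cell S z" using x' assms(5) by auto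
  ultimately show ?thesis using x assms(4) unfolding vor_vertices_def by blast
qed

lemma vor_radius_eq_infdist:
  assumes "v \<in> vor_vertices S"
  shows "vor_radius S v = infdist v S"
proof -
  obtain x y where xy: "x \<in> S" "y \<in> S" "x \<noteq> y" "v \<in> vor_cell S x" "v \<in> vor_cell S y"
    using assms unfolding vor_vertices_def by blast
  have d: "dist v x = infdist v S" "dist v y = infdist v S" using xy by (simp_all add: vor_cell_iff_infdist)
  have "infdist v S \<noteq> 0" using d xy(3) by auto
  then have "0 < infdist v S" using infdist_nonneg[of v S] by linarith
  then show ?thesis unfolding vor_radius_def
    using xy d by (intro the_equality) (auto simp: vor_cell_iff_infdist)
qed

lemma finite_vor_edges_Int_cball:
  assumes "closed S" "discrete S"
  shows "finite {e \<in> vor_edges S. e \<inter> cball p r \<noteq> {}}"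
proof (cases "S = {}")
  case True then show ?thesis by (simp add: vor_edges_def)
next
  case False
  then obtain x0 where x0: "x0 \<in> S" by blast
  \<comment> \<open>A closest site to a point \<open>v\<close> of the ball is no farther from
    \<open>v\<close> than \<open>x0\<close>; the way from \<open>p\<close> through \<open>v\<close>
    costs \<open>r\<close> twice, plus \<open>dist p x0\<close>.\<close>
  define F where "F = S \<inter> cball p (2 * r + dist p x0)"
  have "finite F" unfolding F_def by (rule finite_discrete_Int_cball[OF assms])
  have near: "x \<in> F" if "x \<in> S" "v \<in> vor_cell S x" "v \<in> cball p r" for x v
  proof -
    have "dist v x \<le> dist v x0" using that x0 by (simp add: vor_cell_iff_infdist infdist_le)
    then have "dist p x \<le> 2 * r + dist p x0"
      using dist_triangle[of p x v] dist_triangle3[of v x0 p] that(3) by simp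
    then show ?thesis using that by (simp add: F_def)
  qed
  have "{e \<in> vor_edges S. e \<inter> cball p r \<noteq> {}} \<subseteq> (\<lambda>(x, y). vor_cell S x \<inter> vor_cell S y) ` (F \<times> F)"
  proof
    fix e assume "e \<in> {e \<in> vor_edges S. e \<inter> cball p r \<noteq> {}}"
    then obtain v where e: "e \<in> vor_edges S" and v: "v \<in> e" "v \<in> cball p r" by blast
    from e obtain x y where "x \<in> S" "y \<in> S" "e = vor_cell S x \<inter> vor_cell S y"
      unfolding vor_edges_def by blast
    with v near show "e \<in> (\<lambda>(x, y). vor_cell S x \<inter> vor_cell S y) ` (F \<times> F)" by blast
  qed
  then show ?thesis using \<open>finite F\<close> finite_subset by blast
qed

section \<open>Components of the union of non-centered edges\<close>

lemma noncentered_edges_subset: "noncentered_edges S \<subseteq> vor_edges S"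
  by (auto simp: noncentered_edges_def)

text \<open>The union is locally finite. This serves the separation argument for connectedness and
  the compactness of components.\<close>

lemma closed_Union_vor_edges:
  assumes S: "closed S" "discrete S" and E: "E \<subseteq> vor_edges S"
  shows "closed (\<Union>E)"
proof -
  have edge: "closed e" if "e \<in> E" for e
    using that E by (auto simp: vor_edges_def intro!: closed_Int closed_vor_cell)
  have "open (- \<Union>E)"
  proof (subst open_subopen, intro ballI)
    fix p assume p: "p \<in> - \<Union>E"
    define F where "F = {e \<in> E. e \<inter> cball p 1 \<noteq> {}}"
    have "finite F"
      by (rule finite_subset[OF _ finite_vor_edges_Int_cball[OF S, of p 1]]) (use E in \<open>auto simp: F_def\<close>)
    then have "closed (\<Union>F)" using edge by (intro closed_Union) (auto simp: F_def)
    then have "open (ball p 1 - \<Union>F)" by (intro open_Diff open_ball)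
    moreover have "ball p 1 - \<Union>F \<subseteq> - \<Union>E"
    proof
      fix r assume r: "r \<in> ball p 1 - \<Union>F"
      then have "e \<in> F" if "e \<in> E" "r \<in> e" for e using that by (auto simp: F_def)
      with r show "r \<in> - \<Union>E" by blast
    qed
    moreover have "p \<in> ball p 1 - \<Union>F" using p by (auto simp: F_def)
    ultimately show "\<exists>T. open T \<and> p \<in> T \<and> T \<subseteq> - \<Union>E" by blast
  qed
  then show ?thesis by (simp add: closed_def)
qed

text \<open>A vertex is determined by its set of closest sites, since this set has three elements on
  a circle around it; for vertices in a ball these sets lie in one finite set.\<close>

lemma finite_vor_vertices_Int_cball:
  assumes S: "closed S" "discrete S"
  shows "finite (vor_vertices S \<inter> cball p r)"
proof (cases "S = {}")
  case True then show ?thesis by (simp add: vor_vertices_def)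
next
  case False
  then obtain x0 where x0: "x0 \<in> S" by blast
  define F where "F = S \<inter> cball p (2 * r + dist p x0)"
  define near where "near = (\<lambda>v. {x \<in> S. v \<in> vor_cell S x})"
  have "finite F" unfolding F_def by (rule finite_discrete_Int_cball[OF S])
  have "near v \<subseteq> F" if v: "v \<in> cball p r" for v
  proof
    fix x assume "x \<in> near v"
    then have x: "x \<in> S" "v \<in> vor_cell S x" by (auto simp: near_def)
    have "dist v x \<le> dist v x0" using x x0 by (simp add: vor_cell_iff_infdist infdist_le)
    then have "dist p x \<le> 2 * r + dist p x0"
      using dist_triangle[of p x v] dist_triangle3[of v x0 p] v by simp
    then show "x \<in> F" using x by (simp add: F_def)
  qed
  then have "near ` (vor_vertices S \<inter> cball p r) \<subseteq> Pow F" by blast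
  then have "finite (near ` (vor_vertices S \<inter> cball p r))"
    by (rule finite_subset) (simp add: \<open>finite F\<close>)
  moreover have "inj_on near (vor_vertices S \<inter> cball p r)"
  proof (rule inj_onI, rule ccontr)
    fix v w assume v: "v \<in> vor_vertices S \<inter> cball p r" and eq: "near v = near w" and ne: "v \<noteq> w"
    obtain x y z where xyz: "x \<in> near v" "y \<in> near v" "z \<in> near v" "x \<noteq> y" "y \<noteq> z" "x \<noteq> z"
      using v unfolding vor_vertices_def near_def by blast
    have "dist v u = infdist v S" "dist w u = infdist w S" if "u \<in> near v" for u
      using that that[unfolded eq] by (auto simp: near_def vor_cell_iff_infdist)
    then have "z = x \<or> z = y"
      using xyz(1-3) by (intro circles_meet_at_most_twice[OF ne xyz(4)]) simp_all
    with xyz show False by blast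
  qed
  ultimately show ?thesis by (rule finite_imageD)
qed

lemma noncentered_edge_has_vertex:
  assumes "closed S" "discrete S" "e \<in> noncentered_edges S"
  shows "\<exists>v\<in>e. v \<in> vor_vertices S"
proof -
  obtain x y q U k c where "noncentered_edge_line S e x y q U k c"
    using noncentered_edge_line_exists[OF assms(3)] by blast
  then interpret l: noncentered_edge_line S e x y q U k c .
  show ?thesis using l.least_param[OF assms(1,2)] by blast
qed

lemma connected_noncentered_edge: "e \<in> noncentered_edges S \<Longrightarrow> connected e"
  using noncentered_edge_line_exists noncentered_edge_line.connected_e by blast

lemma edge_subset_component:
  assumes "T \<in> components (\<Union>(noncentered_edges S))" "e \<in> noncentered_edges S" "e \<inter> T \<noteq> {}"
  shows "e \<subseteq> T"
  using assms components_maximal[OF assms(1) connected_noncentered_edge[OF assms(2)]] by blast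

lemma component_eq_Union_edges:
  assumes "T \<in> components (\<Union>(noncentered_edges S))"
  shows "T = \<Union>(edges_of S T)"
proof
  show "T \<subseteq> \<Union>(edges_of S T)"
  proof
    fix p assume p: "p \<in> T"
    then obtain e where "e \<in> noncentered_edges S" "p \<in> e"
      using in_components_subset[OF assms] by blast
    with p edge_subset_component[OF assms] show "p \<in> \<Union>(edges_of S T)"
      unfolding edges_of_def by blast
  qed
qed (auto simp: edges_of_def)

text \<open>
  Both edges of a cycle at its vertex closest to the sites would be ascending there.
\<close>

lemma no_graph_cycle:
  assumes "E \<subseteq> noncentered_edges S"
  shows "\<not> graph_cycle V E vs es"
proof
  assume cyc: "graph_cycle V E vs es"
  define n where "n = length vs"
  have n: "2 \<le> n" "length es = n" "distinct vs" "distinct es" "set es \<subseteq> E"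
    and inc: "\<And>i. i < n \<Longrightarrow> vs ! i \<in> es ! i \<and> vs ! (Suc i mod n) \<in> es ! i"
    using cyc by (auto simp: graph_cycle_def n_def)
  define f where "f = (\<lambda>i. infdist (vs ! i) S)"
  have "\<exists>i\<in>{..<n}. \<forall>j\<in>{..<n}. f i \<le> f j"
  proof -
    have ne: "finite {..<n}" "{..<n} \<noteq> {}" using n(1) by (auto simp: lessThan_empty_iff)
    show ?thesis using arg_min_if_finite(1)[OF ne, of f] arg_min_least[OF ne, of _ f] by blast
  qed
  then obtain i where i: "i < n" and min: "\<And>j. j < n \<Longrightarrow> f i \<le> f j" by auto
  \<comment> \<open>The cyclic predecessor of \<open>i\<close>. For a cycle of length two it equals
    \<open>k\<close>; the contradiction needs only that the edges at \<open>i\<close> and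
    \<open>j\<close> differ.\<close>
  define j where "j = (if i = 0 then n - 1 else i - 1)"
  define k where "k = Suc i mod n"
  have j: "j < n" "j \<noteq> i" "Suc j mod n = i" using i n(1) by (auto simp: j_def)
  have k: "k < n" "k \<noteq> i"
    using i n(1) by (auto simp: k_def mod_Suc)
  have E: "es ! l \<in> noncentered_edges S" if "l < n" for l
    using that n(2,5) assms nth_mem[of l es] by blast
  have in_edges: "vs ! i \<in> es ! i" "vs ! k \<in> es ! i" "vs ! j \<in> es ! j" "vs ! i \<in> es ! j"
    using inc[OF i] inc[OF j(1)] j(3) by (auto simp: k_def)
  have ne: "vs ! i \<noteq> vs ! k" "vs ! i \<noteq> vs ! j"
    using n(3) i j k by (auto simp: nth_eq_iff_index_eq n_def)
  have "f i < f k"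
    using min[OF k(1)] infdist_neq_on_edge[OF E[OF i] in_edges(1,2) ne(1)] by (simp add: f_def)
  moreover have "f i < f j"
    using min[OF j(1)] infdist_neq_on_edge[OF E[OF j(1)] in_edges(4,3) ne(2)] by (simp add: f_def)
  ultimately have "es ! i = es ! j"
    using ascending_edge_unique[OF E[OF i] E[OF j(1)] in_edges(1,4,2) _ in_edges(3)] by (simp add: f_def)
  then show False using n i j by (simp add: nth_eq_iff_index_eq)
qed

text \<open>Edges that meet the set \<open>C\<close> of vertices reachable from \<open>u\<close> and
  edges that miss it form two closed unions covering \<open>T\<close>. A common point would be a
  vertex and thus reachable, so the unions are disjoint and connectedness empties the
  second.\<close>

lemma graph_connected_component:
  assumes S: "closed S" "discrete S" and T: "T \<in> components (\<Union>(noncentered_edges S))"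
  shows "graph_connected (vertices_of S T) (edges_of S T)"
proof -
  let ?V = "vertices_of S T" and ?E = "edges_of S T"
  let ?A = "{(a, b). a \<in> ?V \<and> b \<in> ?V \<and> (\<exists>e\<in>?E. a \<in> e \<and> b \<in> e)}"
  have E_sub: "?E \<subseteq> noncentered_edges S" "?E \<subseteq> vor_edges S"
    using noncentered_edges_subset by (auto simp: edges_of_def)
  have T_eq: "T = \<Union>?E" by (rule component_eq_Union_edges[OF T])
  have vertex: "\<exists>v\<in>?V. v \<in> e" if e: "e \<in> ?E" for e
    using noncentered_edge_has_vertex[OF S, of e] e by (auto simp: edges_of_def vertices_of_def)
  have "T \<noteq> {}" using in_components_nonempty[OF T] .
  then have "?V \<noteq> {}" using T_eq vertex by blast
  moreover have "(u, v) \<in> ?A\<^sup>*" if u: "u \<in> ?V" and v: "v \<in> ?V" for u v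
  proof -
    define C where "C = {w \<in> ?V. (u, w) \<in> ?A\<^sup>*}"
    define E1 where "E1 = {e \<in> ?E. e \<inter> C \<noteq> {}}"
    define E2 where "E2 = {e \<in> ?E. e \<inter> C = {}}"
    have closed: "closed (\<Union>E1)" "closed (\<Union>E2)"
      by (rule closed_Union_vor_edges[OF S]; use E_sub in \<open>auto simp: E1_def E2_def\<close>)+
    have "\<Union>E1 \<inter> \<Union>E2 = {}"
    proof (rule ccontr)
      assume "\<Union>E1 \<inter> \<Union>E2 \<noteq> {}"
      then obtain p e f where pef: "p \<in> e" "p \<in> f" "e \<in> E1" "f \<in> E2" by blast
      then have ef: "e \<in> ?E" "f \<in> ?E" "e \<noteq> f" by (auto simp: E1_def E2_def)
      then have "p \<in> vor_vertices S"
        using vor_edges_Int_vertex pef(1,2) E_sub by (meson subsetD)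
      then have p: "p \<in> ?V" using pef ef T_eq by (auto simp: vertices_of_def)
      obtain w where w: "w \<in> C" "w \<in> e" using pef by (auto simp: E1_def)
      then have "(w, p) \<in> ?A" using p pef ef by (auto simp: C_def)
      then have "p \<in> C" using w p by (auto simp: C_def intro: rtrancl_into_rtrancl)
      then show False using pef by (auto simp: E2_def)
    qed
    moreover have T12: "T \<subseteq> \<Union>E1 \<union> \<Union>E2"
    proof
      fix p assume "p \<in> T"
      then obtain e where "e \<in> ?E" "p \<in> e" using T_eq by blast
      then show "p \<in> \<Union>E1 \<union> \<Union>E2" by (auto simp: E1_def E2_def)
    qed
    moreover have u1: "u \<in> \<Union>E1"
    proof -
      have "u \<in> C" using u by (simp add: C_def)
      moreover obtain e where "e \<in> ?E" "u \<in> e" using u T_eq by (auto simp: vertices_of_def)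
      ultimately show ?thesis by (auto simp: E1_def)
    qed
    ultimately have "\<Union>E2 \<inter> T = {}"
      using connected_closedD[OF in_components_connected[OF T], of "\<Union>E1" "\<Union>E2"] closed u
      by (auto simp: vertices_of_def)
    moreover obtain e where e: "e \<in> ?E" "v \<in> e" using v T_eq by (auto simp: vertices_of_def)
    moreover have "v \<in> T" using v by (simp add: vertices_of_def)
    ultimately have "e \<in> E1" by (auto simp: E1_def E2_def)
    then obtain w where w: "w \<in> C" "w \<in> e" by (auto simp: E1_def)
    then have "(w, v) \<in> ?A" using e v by (auto simp: C_def)
    then show ?thesis using w by (auto simp: C_def intro: rtrancl_into_rtrancl)
  qed
  ultimately show ?thesis by (auto simp: graph_connected_def)
qed

lemma graph_tree_component:
  assumes "closed S" "discrete S" "T \<in> components (\<Union>(noncentered_edges S))"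
  shows "graph_tree (vertices_of S T) (edges_of S T)"
  using graph_connected_component[OF assms] no_graph_cycle[of "edges_of S T" S]
  by (auto simp: graph_tree_def edges_of_def)

section \<open>Components when the height is bounded\<close>

lemma noncentered_edge_two_vertices:
  assumes S: "closed S" "discrete S" and bdd: "\<And>p. infdist p S \<le> R" and e: "e \<in> noncentered_edges S"
  obtains v w where "e \<inter> vor_vertices S = {v, w}" "v \<noteq> w"
proof -
  obtain x y q U k c where "noncentered_edge_line S e x y q U k c"
    using noncentered_edge_line_exists[OF e] by blast
  then interpret l: noncentered_edge_line S e x y q U k c .
  obtain a where a: "q a \<in> e" "q a \<in> vor_vertices S" "\<And>t. q t \<in> e \<Longrightarrow> a \<le> t"
    using l.least_param[OF S] by blast
  obtain b where b: "q b \<in> e" "q b \<in> vor_vertices S" "\<And>t. q t \<in> e \<Longrightarrow> t \<le> b"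
    using l.greatest_param[OF S bdd] by blast
  have "a < b" using l.nondegenerate a(3) b(3) by (meson le_less_trans less_le_trans)
  have "p = q a \<or> p = q b" if p: "p \<in> e" "p \<in> vor_vertices S" for p
  proof -
    obtain t where t: "p = q t" using l.param p by blast
    have "a \<le> t" "t \<le> b" using p a(3) b(3) t by auto
    moreover have "\<not> (a < t \<and> t < b)" using l.interior_not_vertex[OF a(1) b(1)] p t by blast
    ultimately have "t = a \<or> t = b" by linarith
    then show ?thesis using t by blast
  qed
  then have "e \<inter> vor_vertices S = {q a, q b}" using a b by blast
  moreover have "q a \<noteq> q b" using \<open>a < b\<close> l.q_inj by simp
  ultimately show thesis by (rule that)
qed

lemma noncentered_edge_diameter:
  assumes bdd: "\<And>p. infdist p S \<le> R" and e: "e \<in> noncentered_edges S" and "p \<in> e" "r \<in> e"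
  shows "dist p r \<le> 2 * R"
proof -
  obtain x where "x \<in> S" "e \<subseteq> vor_cell S x"
    using e by (auto simp: noncentered_edges_def vor_edges_def)
  then have "dist p x \<le> R" "dist r x \<le> R"
    using assms(3,4) bdd vor_cell_iff_infdist by (metis subsetD)+
  then show ?thesis using dist_triangle2[of p r x] by simp
qed

text \<open>Finiteness follows from a bound on the distance to the highest vertex: ascending paths
  are short, because every step uses up one of finitely many heights.\<close>

lemma component_with_bounded_heights:
  assumes S: "closed S" "discrete S" and bdd: "\<And>p. infdist p S \<le> R"
    and fin: "finite ((\<lambda>v. infdist v S) ` vor_vertices S)"
    and T: "T \<in> components (\<Union>(noncentered_edges S))"
  shows "finite (vertices_of S T)" "finite (edges_of S T)" "compact T"
    "\<exists>m\<in>vertices_of S T. \<forall>u\<in>vertices_of S T - {m}. infdist u S < infdist m S"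
proof -
  let ?V = "vertices_of S T" and ?E = "edges_of S T"
  let ?A = "{(a, b). a \<in> ?V \<and> b \<in> ?V \<and> (\<exists>e\<in>?E. a \<in> e \<and> b \<in> e)}"
  define h where "h = (\<lambda>v. infdist v S)"
  define Asc where "Asc = {(a, b) \<in> ?A. h a < h b}"
  have conn: "?V \<noteq> {}" "\<And>u v. u \<in> ?V \<Longrightarrow> v \<in> ?V \<Longrightarrow> (u, v) \<in> ?A\<^sup>*"
    using graph_connected_component[OF S T] by (auto simp: graph_connected_def)
  have E: "e \<in> noncentered_edges S" if "e \<in> ?E" for e using that by (simp add: edges_of_def)
  have V: "v \<in> vor_vertices S" "v \<in> T" if "v \<in> ?V" for v using that by (simp_all add: vertices_of_def)
  have fin_h: "finite (h ` ?V)"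
    by (rule finite_subset[OF _ fin]) (auto simp: h_def V)
  obtain m where m: "m \<in> ?V" and max: "\<And>u. u \<in> ?V \<Longrightarrow> h u \<le> h m"
  proof -
    have "Max (h ` ?V) \<in> h ` ?V" using fin_h conn(1) by (intro Max_in) auto
    then obtain m where "m \<in> ?V" "Max (h ` ?V) = h m" by blast
    with fin_h that show thesis by (metis Max_ge imageI)
  qed
  \<comment> \<open>Induction along an arbitrary path that starts at \<open>m\<close>; each step
    either prolongs the ascending path or cancels its first edge.\<close>
  have asc: "(u, m) \<in> Asc\<^sup>*" if "u \<in> ?V" for u
    using conn(2)[OF m that]
  proof (induction rule: rtrancl_induct)
    case (step u u')
    then obtain e where e: "u \<in> ?V" "u' \<in> ?V" "e \<in> ?E" "u \<in> e" "u' \<in> e" by blast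
    show ?case
    proof (cases "u = u'")
      case True with step show ?thesis by simp
    next
      case False
      then have "h u \<noteq> h u'" unfolding h_def using infdist_neq_on_edge[OF E[OF e(3)] e(4,5)] by blast
      then consider "h u' < h u" | "h u < h u'" by linarith
      then show ?thesis
      proof cases
        case 1
        then have "(u', u) \<in> Asc" using e by (auto simp: Asc_def)
        then show ?thesis using step.IH by (rule converse_rtrancl_into_rtrancl)
      next
        case 2
        \<comment> \<open>The step leads upwards from \<open>u\<close>, and the known ascending path
          from \<open>u\<close> to \<open>m\<close> also starts upwards. Both use the same edge, and
          since an edge has only two vertices, \<open>u'\<close> is already on that path.\<close>
        then have "u \<noteq> m" using max[OF e(2)] by auto
        with step.IH obtain w where w: "(u, w) \<in> Asc" "(w, m) \<in> Asc\<^sup>*" by (metis converse_rtranclE)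
        then obtain f where f: "w \<in> ?V" "f \<in> ?E" "u \<in> f" "w \<in> f" "h u < h w" by (auto simp: Asc_def)
        have "e = f"
          using ascending_edge_unique[OF E[OF e(3)] E[OF f(2)] e(4) f(3) e(5) _ f(4)] 2 f(5)
          by (simp add: h_def)
        moreover obtain v v' where "e \<inter> vor_vertices S = {v, v'}"
          using noncentered_edge_two_vertices[OF S bdd E[OF e(3)]] by blast
        ultimately have "{u, u', w} \<subseteq> {v, v'}" using e f V by blast
        then have "w = u'" using 2 f(5) by auto
        with w show ?thesis by simp
      qed
    qed
  qed simp
  have less: "h u < h m" if u: "u \<in> ?V" "u \<noteq> m" for u
  proof -
    obtain w where "(u, w) \<in> Asc" using asc[OF u(1)] u(2) by (metis converse_rtranclE)
    then have "h u < h w" "w \<in> ?V" by (auto simp: Asc_def)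
    with max show ?thesis by fastforce
  qed
  then show "\<exists>m\<in>?V. \<forall>u\<in>?V - {m}. infdist u S < infdist m S" using m by (auto simp: h_def)
  have "0 \<le> R" using bdd infdist_nonneg order_trans by blast
  \<comment> \<open>An edge has diameter at most \<open>2 * R\<close>, and the number of heights
    above the current vertex drops with every ascending step.\<close>
  define B where "B = 2 * R * card (h ` ?V)"
  have near: "dist u m \<le> B" if "u \<in> ?V" for u
  proof -
    have "dist u m \<le> 2 * R * card {j \<in> h ` ?V. h u < j}"
      using asc[OF that]
    proof (induction rule: converse_rtrancl_induct)
      case (step u w)
      then obtain e where e: "w \<in> ?V" "e \<in> ?E" "u \<in> e" "w \<in> e" "h u < h w" by (auto simp: Asc_def)
      have "insert (h w) {j \<in> h ` ?V. h w < j} \<subseteq> {j \<in> h ` ?V. h u < j}" using e by auto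
      then have "card (insert (h w) {j \<in> h ` ?V. h w < j}) \<le> card {j \<in> h ` ?V. h u < j}"
        using fin_h by (intro card_mono) auto
      then have "1 + card {j \<in> h ` ?V. h w < j} \<le> card {j \<in> h ` ?V. h u < j}"
        using fin_h by simp
      then have "2 * R * real (1 + card {j \<in> h ` ?V. h w < j}) \<le> 2 * R * real (card {j \<in> h ` ?V. h u < j})"
        using \<open>0 \<le> R\<close> by (intro mult_left_mono) (simp_all del: of_nat_add)
      moreover have "dist u w \<le> 2 * R" using noncentered_edge_diameter[OF bdd E[OF e(2)] e(3,4)] .
      ultimately show ?case using step.IH dist_triangle[of u m w] by (simp add: algebra_simps)
    qed (use \<open>0 \<le> R\<close> in simp)
    also have "\<dots> \<le> B" unfolding B_def
      using \<open>0 \<le> R\<close> fin_h by (intro mult_left_mono) (auto intro: card_mono)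
    finally show ?thesis .
  qed
  then have "?V \<subseteq> vor_vertices S \<inter> cball m B" using V by (auto simp: dist_commute)
  then show "finite ?V" using finite_vor_vertices_Int_cball[OF S] finite_subset by blast
  have edge_near: "\<exists>v\<in>e. dist v m \<le> B" if e: "e \<in> ?E" for e
    using noncentered_edge_has_vertex[OF S E[OF e]] near e by (auto simp: vertices_of_def edges_of_def)
  have "?E \<subseteq> {e \<in> vor_edges S. e \<inter> cball m B \<noteq> {}}"
    using edge_near noncentered_edges_subset E by (fastforce simp: dist_commute)
  then show "finite ?E" using finite_vor_edges_Int_cball[OF S] finite_subset by blast
  have "T \<subseteq> cball m (B + 2 * R)"
  proof
    fix p assume "p \<in> T"
    then obtain e where e: "e \<in> ?E" "p \<in> e" using component_eq_Union_edges[OF T] by blast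
    then obtain v where "v \<in> e" "dist v m \<le> B" using edge_near by blast
    moreover have "dist p v \<le> 2 * R"
      using noncentered_edge_diameter[OF bdd E[OF e(1)] e(2)] \<open>v \<in> e\<close> by blast
    ultimately show "p \<in> cball m (B + 2 * R)"
      using dist_triangle[of p m v] by (simp add: dist_commute)
  qed
  then have "bounded T" using bounded_subset bounded_cball by blast
  moreover have "closed T"
  proof -
    have "closed (\<Union>?E)"
      using E noncentered_edges_subset by (intro closed_Union_vor_edges[OF S]) blast
    then show ?thesis using component_eq_Union_edges[OF T] by simp
  qed
  ultimately show "compact T" by (rule compact_hyp_plane)
qed

section \<open>Symmetries\<close>

definition site_isometry :: "hyp_plane set \<Rightarrow> (hyp_plane \<Rightarrow> hyp_plane) \<Rightarrow> bool" where
  "site_isometry S g \<longleftrightarrow> bij g \<and> (\<forall>p q. dist (g p) (g q) = dist p q) \<and> g ` S = S"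

lemma site_isometry_inv:
  assumes "site_isometry S g"
  shows "site_isometry S (inv g)"
  unfolding site_isometry_def
proof (intro conjI allI)
  have g: "bij g" "\<And>p q. dist (g p) (g q) = dist p q" "g ` S = S"
    using assms by (simp_all add: site_isometry_def)
  show "bij (inv g)" using g(1) by (rule bij_imp_bij_inv)
  show "dist (inv g p) (inv g q) = dist p q" for p q
    using g(2)[of "inv g p" "inv g q"] g(1) by (simp add: surj_f_inv_f bij_is_surj)
  show "inv g ` S = S" using g(1,3) by (metis bij_is_inj image_inv_f_f)
qed

lemma vor_cell_isometry_image:
  assumes "site_isometry S g"
  shows "g ` vor_cell S x = vor_cell S (g x)"
proof -
  have g: "bij g" "\<And>p q. dist (g p) (g q) = dist p q" "g ` S = S"
    using assms by (simp_all add: site_isometry_def)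
  have "S - {g x} = g ` (S - {x})"
    using g(3) image_set_diff[OF bij_is_inj[OF g(1)], of S "{x}"] by simp
  then have iff: "g p \<in> vor_cell S (g x) \<longleftrightarrow> p \<in> vor_cell S x" for p
    by (simp add: vor_cell_def g(2))
  show ?thesis
  proof
    show "vor_cell S (g x) \<subseteq> g ` vor_cell S x"
    proof
      fix r assume r: "r \<in> vor_cell S (g x)"
      obtain p where "r = g p" using bij_is_surj[OF g(1)] by blast
      with r iff show "r \<in> g ` vor_cell S x" by blast
    qed
  qed (use iff in blast)
qed

lemma vor_vertices_isometry:
  assumes g: "site_isometry S g" and v: "v \<in> vor_vertices S"
  shows "g v \<in> vor_vertices S"
proof -
  obtain x y z where xyz: "x \<in> S" "y \<in> S" "z \<in> S" "x \<noteq> y" "y \<noteq> z" "x \<noteq> z"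
    "v \<in> vor_cell S x" "v \<in> vor_cell S y" "v \<in> vor_cell S z"
    using v unfolding vor_vertices_def by blast
  have "inj g" "g ` S = S" using g by (auto simp: site_isometry_def bij_is_inj)
  then have "g x \<in> S" "g y \<in> S" "g z \<in> S" "g x \<noteq> g y" "g y \<noteq> g z" "g x \<noteq> g z"
    using xyz(1-6) by (auto simp: inj_eq)
  moreover have "g v \<in> vor_cell S (g x)" "g v \<in> vor_cell S (g y)" "g v \<in> vor_cell S (g z)"
    using xyz(7-9) by (auto simp flip: vor_cell_isometry_image[OF g])
  ultimately show ?thesis unfolding vor_vertices_def by blast
qed

lemma infdist_isometry:
  assumes "site_isometry S g"
  shows "infdist (g p) S = infdist p S"
proof -
  have g: "\<And>p q. dist (g p) (g q) = dist p q" "g ` S = S"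
    using assms by (simp_all add: site_isometry_def)
  have "(INF a\<in>g ` S. dist (g p) a) = (INF a\<in>S. dist p a)" by (simp add: image_image g(1))
  then show ?thesis by (simp add: infdist_def g(2))
qed

lemma geodesic_arc_isometry:
  assumes g: "\<And>p q. dist (g p) (g q) = dist p q" and "r \<in> geodesic_arc x y"
  shows "g r \<in> geodesic_arc (g x) (g y)"
proof -
  obtain l t where l: "r = l t" "t \<in> {0..dist x y}" "l 0 = x" "l (dist x y) = y"
    "\<forall>r\<in>{0..dist x y}. \<forall>s\<in>{0..dist x y}. dist (l r) (l s) = \<bar>r - s\<bar>"
    using assms(2) unfolding geodesic_arc_def by blast
  then show ?thesis unfolding geodesic_arc_def g
    by (intro CollectI exI[of _ "g \<circ> l"] exI[of _ t]) (simp add: g)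
qed

lemma vor_edge_isometry_image:
  assumes g: "site_isometry S g" and xy: "x \<in> S" "y \<in> S" "x \<noteq> y" and e: "e = vor_cell S x \<inter> vor_cell S y"
  shows "g x \<in> S" "g y \<in> S" "g x \<noteq> g y" "g ` e = vor_cell S (g x) \<inter> vor_cell S (g y)"
proof -
  have "inj g" "g ` S = S" using g by (auto simp: site_isometry_def bij_is_inj)
  then show "g x \<in> S" "g y \<in> S" "g x \<noteq> g y" "g ` e = vor_cell S (g x) \<inter> vor_cell S (g y)"
    using xy by (auto simp: inj_eq e image_Int simp flip: vor_cell_isometry_image[OF g])
qed

lemma vor_edges_isometry:
  assumes g: "site_isometry S g" and e: "e \<in> vor_edges S"
  shows "g ` e \<in> vor_edges S"
proof -
  obtain x y p q where xy: "x \<in> S" "y \<in> S" "x \<noteq> y" "e = vor_cell S x \<inter> vor_cell S y"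
    and pq: "p \<in> e" "q \<in> e" "p \<noteq> q"
    using e unfolding vor_edges_def by blast
  have "inj g" using g by (auto simp: site_isometry_def bij_is_inj)
  then have "g p \<in> g ` e" "g q \<in> g ` e" "g p \<noteq> g q" using pq by (auto simp: inj_eq)
  then show ?thesis using vor_edge_isometry_image[OF g xy] unfolding vor_edges_def by blast
qed

lemma centered_edge_isometry:
  assumes g: "site_isometry S g" and e: "centered_edge S e"
  shows "centered_edge S (g ` e)"
proof -
  have g': "inj g" "\<And>p q. dist (g p) (g q) = dist p q"
    using g by (auto simp: site_isometry_def bij_is_inj)
  obtain x y p where xy: "x \<in> S" "y \<in> S" "x \<noteq> y" "e = vor_cell S x \<inter> vor_cell S y"
    and p: "p \<in> geodesic_arc x y" "p \<in> edge_interior e" and "e \<in> vor_edges S"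
    using e unfolding centered_edge_def by blast
  obtain a b where "p \<in> e" "a \<in> e" "b \<in> e" "a \<noteq> p" "b \<noteq> p" "p \<in> geodesic_arc a b"
    using p(2) unfolding edge_interior_def by blast
  then have "g p \<in> g ` e" "g a \<in> g ` e" "g b \<in> g ` e" "g a \<noteq> g p" "g b \<noteq> g p"
    "g p \<in> geodesic_arc (g a) (g b)"
    using g'(1) geodesic_arc_isometry[of g, OF g'(2)] by (auto simp: inj_eq)
  then have "g p \<in> edge_interior (g ` e)" unfolding edge_interior_def by blast
  moreover have "g p \<in> geodesic_arc (g x) (g y)" using geodesic_arc_isometry[of g, OF g'(2) p(1)] .
  ultimately show ?thesis
    using vor_edge_isometry_image[OF g xy] vor_edges_isometry[OF g \<open>e \<in> vor_edges S\<close>]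
    unfolding centered_edge_def by blast
qed

text \<open>If the image were centered, the inverse isometry would carry this back to
  \<open>e\<close>.\<close>

lemma noncentered_edges_isometry:
  assumes g: "site_isometry S g" and e: "e \<in> noncentered_edges S"
  shows "g ` e \<in> noncentered_edges S"
proof -
  have "inv g ` g ` e = e"
    using g by (simp add: site_isometry_def bij_is_inj image_inv_f_f)
  then have "\<not> centered_edge S (g ` e)"
    using centered_edge_isometry[OF site_isometry_inv[OF g], of "g ` e"] e
    by (auto simp: noncentered_edges_def)
  then show ?thesis using e vor_edges_isometry[OF g] by (auto simp: noncentered_edges_def)
qed

section \<open>Deck transformations\<close>

text \<open>Used to replace the hyperbolic plane by R^2 and the surface by an isometric copy in a
  normed space.\<close>

lemma covering_space_homeomorphic:
  fixes p :: "'a::topological_space \<Rightarrow> 'b::topological_space"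
    and f :: "'c::topological_space \<Rightarrow> 'a" and j :: "'b \<Rightarrow> 'd::topological_space"
  assumes cov: "covering_space UNIV p S" and f: "homeomorphism UNIV UNIV f f'"
    and j: "homeomorphism S S' j j'"
  shows "covering_space UNIV (j \<circ> p \<circ> f) S'"
proof -
  have p: "continuous_on UNIV p" "range p = S"
    using cov by (auto simp: covering_space_def)
  have cont_f: "continuous_on UNIV f" and ff': "f (f' a) = a" "f' (f d) = d" for a d
    using f by (auto simp: homeomorphism_def)
  have surj_f: "range f = UNIV" using ff' by (metis surjI)
  have cont_j: "continuous_on S j" and jS: "j ` S = S'"
    and jj': "s \<in> S \<Longrightarrow> j' (j s) = s" "s' \<in> S' \<Longrightarrow> j (j' s') = s'" for s s'
    using j by (auto simp: homeomorphism_def)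
  have inS: "p a \<in> S" for a using p(2) by blast
  show ?thesis unfolding covering_space_def
  proof (intro conjI ballI)
    show "continuous_on UNIV (j \<circ> p \<circ> f)"
      using p cont_j cont_f surj_f by (intro continuous_on_compose) (auto simp: image_comp)
    show "range (j \<circ> p \<circ> f) = S'"
      unfolding image_comp[symmetric] surj_f p(2) jS ..
    fix s' assume "s' \<in> S'"
    then obtain s where s: "s \<in> S" "s' = j s" using jS by blast
    then obtain T v where T: "s \<in> T" "openin (top_of_set S) T" "\<Union>v = UNIV \<inter> p -` T"
      and v: "\<And>u. u \<in> v \<Longrightarrow> openin (top_of_set UNIV) u" "pairwise disjnt v"
        "\<And>u. u \<in> v \<Longrightarrow> \<exists>q. homeomorphism u T p q"
      using cov unfolding covering_space_def by meson
    have TS: "T \<subseteq> S" using T(2) by (rule openin_imp_subset)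
    let ?v = "(\<lambda>u. f -` u) ` v"
    show "\<exists>T. s' \<in> T \<and> openin (top_of_set S') T \<and> (\<exists>v. \<Union>v = UNIV \<inter> (j \<circ> p \<circ> f) -` T \<and>
       (\<forall>u\<in>v. openin (top_of_set UNIV) u) \<and> pairwise disjnt v \<and>
       (\<forall>u\<in>v. \<exists>q. homeomorphism u T (j \<circ> p \<circ> f) q))"
    proof (intro exI[of _ "j ` T"] conjI exI[of _ ?v] ballI)
      show "s' \<in> j ` T" using s T by blast
      show "openin (top_of_set S') (j ` T)"
        by (rule homeomorphism_imp_open_map[OF j T(2)])
      show "\<Union>?v = UNIV \<inter> (j \<circ> p \<circ> f) -` (j ` T)"
      proof (rule set_eqI)
        fix d
        have "d \<in> \<Union>?v \<longleftrightarrow> f d \<in> \<Union>v" by blast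
        also have "\<dots> \<longleftrightarrow> p (f d) \<in> T" unfolding T(3) by simp
        also have "\<dots> \<longleftrightarrow> j (p (f d)) \<in> j ` T"
        proof
          assume "j (p (f d)) \<in> j ` T"
          then obtain t where t: "t \<in> T" "j (p (f d)) = j t" by blast
          then have "t = p (f d)" using jj'(1)[OF inS, of "f d"] jj'(1)[of t] TS by auto
          with t show "p (f d) \<in> T" by simp
        qed (rule imageI)
        finally show "d \<in> \<Union>?v \<longleftrightarrow> d \<in> UNIV \<inter> (j \<circ> p \<circ> f) -` (j ` T)" by simp
      qed
      show "pairwise disjnt ?v"
        using v(2) unfolding pairwise_def disjnt_def by blast
    next
      fix w assume "w \<in> ?v"
      then obtain u where u: "u \<in> v" "w = f -` u" by blast
      have "open u" using v(1)[OF u(1)] by simp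
      then show "openin (top_of_set UNIV) w"
        using cont_f u(2) by (simp add: continuous_on_open_vimage[OF open_UNIV])
      obtain q where q: "homeomorphism u T p q" using v(3)[OF u(1)] by blast
      have "f ` w = u" using u(2) surj_f by (metis image_vimage_eq inf_top.right_neutral)
      then have "homeomorphism w u f f'" using homeomorphism_of_subsets[OF f, of w] by simp
      moreover have "homeomorphism T (j ` T) j j'" using homeomorphism_of_subsets[OF j TS subset_refl refl] .
      ultimately have "homeomorphism w (j ` T) (j \<circ> (p \<circ> f)) ((f' \<circ> q) \<circ> j')"
        using q by (meson homeomorphism_compose)
      then show "\<exists>q. homeomorphism w (j ` T) (j \<circ> p \<circ> f) q" by (auto simp: comp_assoc)
    qed
  qed
qed

text \<open>
  The Kuratowski embedding; it makes the lifting theorems of the library, which are stated for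
  normed spaces, available for coverings of an arbitrary metric space.
\<close>

lemma metric_space_embeds_in_normed_space:
  "\<exists>j :: 'a::metric_space \<Rightarrow> 'a \<Rightarrow>\<^sub>C real. \<forall>x y. dist (j x) (j y) = dist x y"
proof -
  define a :: 'a where "a = undefined"
  \<comment> \<open>Subtracting the distance to a fixed point \<open>a\<close> makes the function
    bounded; the lower bound for the distance is attained at \<open>z = y\<close>.\<close>
  define j :: "'a \<Rightarrow> 'a \<Rightarrow>\<^sub>C real" where "j = (\<lambda>x. Bcontfun (\<lambda>z. dist x z - dist a z))"
  have "(\<lambda>z. dist x z - dist a z) \<in> bcontfun" for x
  proof (rule bcontfun_normI)
    show "continuous_on UNIV (\<lambda>z. dist x z - dist a z)" by (intro continuous_intros)
    show "norm (dist x z - dist a z) \<le> dist x a" for z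
      using dist_triangle[of x z a] dist_triangle[of a z x] by (simp add: dist_commute abs_le_iff)
  qed
  then have j: "apply_bcontfun (j x) z = dist x z - dist a z" for x z
    by (simp add: j_def Bcontfun_inverse)
  have "dist (j x) (j y) = dist x y" for x y
  proof (rule order_antisym)
    show "dist (j x) (j y) \<le> dist x y"
    proof (rule dist_bound)
      show "dist (apply_bcontfun (j x) z) (apply_bcontfun (j y) z) \<le> dist x y" for z
        using dist_triangle[of x z y] dist_triangle[of y z x]
        by (simp add: j dist_real_def dist_commute abs_le_iff)
    qed
    show "dist x y \<le> dist (j x) (j y)"
      using dist_bounded[of "j x" y "j y"] by (simp add: j dist_real_def)
  qed
  then show ?thesis by blast
qed

lemma isometry_homeomorphism:
  fixes j :: "'a::metric_space \<Rightarrow> 'b::metric_space"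
  assumes j: "\<And>x y. dist (j x) (j y) = dist x y"
  shows "homeomorphism F (j ` F) j (inv j)"
proof -
  have "inj j" using j by (metis dist_eq_0_iff injI)
  then have inv: "inv j (j x) = x" for x by simp
  have "continuous_on F j" unfolding continuous_on_iff j by blast
  moreover have "continuous_on (j ` F) (inv j)"
    unfolding continuous_on_iff by (auto simp: inv j)
  ultimately show ?thesis by (auto simp: homeomorphism_def inv image_image)
qed

section \<open>Lifts of the covering through itself\<close>

context
  fixes \<pi> :: "hyp_plane \<Rightarrow> 'a::metric_space" and F :: "'a set"
  assumes cov: "covering_space UNIV \<pi> F"
begin

lemma covering_lift_exists:
  assumes "\<pi> p = \<pi> q"
  obtains g where "continuous_on UNIV g" "g p = q" "\<And>z. \<pi> (g z) = \<pi> z"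
proof -
  obtain j :: "'a \<Rightarrow> 'a \<Rightarrow>\<^sub>C real" where j: "\<And>x y. dist (j x) (j y) = dist x y"
    using metric_space_embeds_in_normed_space by blast
  then have inj: "j x = j y \<longleftrightarrow> x = y" for x y by (metis dist_eq_0_iff)
  let ?P = "j \<circ> \<pi> \<circ> hyp_of" and ?f = "\<lambda>p. fst (Rep_hyp_plane p)"
  have P: "covering_space UNIV ?P (j ` F)"
    by (rule covering_space_homeomorphic[OF cov homeomorphism_hyp_of isometry_homeomorphism[OF j]])
  have eq: "?P (?f p) = ?P (?f q)" using assms by (simp add: hyp_of_fst_Rep)
  obtain G where G: "continuous_on UNIV G" "G (?f p) = ?f q" "\<And>y. ?P (G y) = ?P y"
  proof (rule covering_space_lift_strong[OF P UNIV_I, where f = ?P and a = "?f q" and z = "?f p" and U = UNIV])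
    show "?P (?f p) = ?P (?f q)" by (rule eq)
    show "simply_connected (UNIV :: (real^2) set)" by (rule convex_imp_simply_connected) simp
    show "locally path_connected (UNIV :: (real^2) set)" by (rule locally_path_connected_UNIV)
    show "continuous_on UNIV ?P" using P by (simp add: covering_space_def)
    show "?P \<in> UNIV \<rightarrow> j ` F" using P by (auto simp: covering_space_def)
  qed auto
  show thesis
  proof (rule that[of "hyp_of \<circ> G \<circ> ?f"])
    show "continuous_on UNIV (hyp_of \<circ> G \<circ> ?f)"
      by (intro continuous_on_compose continuous_on_fst_Rep continuous_on_hyp_of continuous_on_subset[OF G(1)]) auto
    show "(hyp_of \<circ> G \<circ> ?f) p = q" by (simp add: G hyp_of_fst_Rep)
    show "\<pi> ((hyp_of \<circ> G \<circ> ?f) z) = \<pi> z" for z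
      using G(3)[of "?f z"] by (simp add: inj hyp_of_fst_Rep)
  qed
qed

text \<open>Gives both the inverse of a deck transformation and the rule that one with a fixed point
  is the identity.\<close>

lemma covering_lift_unique:
  assumes g: "continuous_on UNIV g" "\<And>z. \<pi> (g z) = \<pi> z"
    and h: "continuous_on UNIV h" "\<And>z. \<pi> (h z) = \<pi> z"
    and "g p = h p"
  shows "g = h"
proof
  fix r
  obtain j :: "'a \<Rightarrow> 'a \<Rightarrow>\<^sub>C real" where j: "\<And>x y. dist (j x) (j y) = dist x y"
    using metric_space_embeds_in_normed_space by blast
  let ?P = "j \<circ> \<pi> \<circ> hyp_of" and ?f = "\<lambda>p. fst (Rep_hyp_plane p)"
  have P: "covering_space UNIV ?P (j ` F)"
    by (rule covering_space_homeomorphic[OF cov homeomorphism_hyp_of isometry_homeomorphism[OF j]])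
  have cont: "continuous_on UNIV (?f \<circ> k \<circ> hyp_of)" if "continuous_on UNIV k" for k
    by (intro continuous_on_compose continuous_on_fst_Rep continuous_on_hyp_of continuous_on_subset[OF that]) auto
  have "?P \<in> UNIV \<rightarrow> j ` F" "continuous_on UNIV ?P" using P by (auto simp: covering_space_def)
  then have "(?f \<circ> g \<circ> hyp_of) (?f r) = (?f \<circ> h \<circ> hyp_of) (?f r)"
    using covering_space_lift_unique[OF P,
        of "?f \<circ> g \<circ> hyp_of" "?f p" "?f \<circ> h \<circ> hyp_of" UNIV ?P "?f r"]
      cont[OF g(1)] cont[OF h(1)]
    by (simp add: hyp_of_fst_Rep g(2) h(2) assms(5) convex_connected)
  then have "?f (g r) = ?f (h r)" by (simp add: hyp_of_fst_Rep)
  then show "g r = h r" by (metis hyp_of_fst_Rep)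
qed

end

lemma locally_nonexpanding_imp_nonexpanding:
  fixes g :: "hyp_plane \<Rightarrow> 'b::metric_space"
  assumes loc: "\<And>a. \<exists>d>0. \<forall>b\<in>ball a d. \<forall>c\<in>ball a d. dist (g b) (g c) \<le> dist b c"
  shows "dist (g p) (g q) \<le> dist p q"
proof (cases "p = q")
  case False
  obtain l U where l: "l 0 = p" "l (dist p q) = q" "lorentz U U = - 1" "lorentz (Rep_hyp_plane p) U = 0"
      "\<And>t. Rep_hyp_plane (l t) = cosh t *\<^sub>R Rep_hyp_plane p + sinh t *\<^sub>R U"
      "\<And>r s. dist (l r) (l s) = \<bar>r - s\<bar>"
    by (rule geodesic_line_through[OF False], rule that, assumption+)
  have "dist (g (l 0)) (g (l (dist p q))) \<le> dist p q - 0"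
  \<comment> \<open>The estimate is additive over adjacent parameter intervals and true for short
    ones, so it holds for the whole geodesic, whose length is \<open>dist p q\<close>.\<close>
  proof (rule Bolzano[of 0 "dist p q" "\<lambda>r s. dist (g (l r)) (g (l s)) \<le> s - r"])
    fix a b c assume "dist (g (l a)) (g (l b)) \<le> b - a" "dist (g (l b)) (g (l c)) \<le> c - b"
    then show "dist (g (l a)) (g (l c)) \<le> c - a"
      using dist_triangle[of "g (l a)" "g (l c)" "g (l b)"] by linarith
  next
    fix x
    obtain d where d: "d > 0" "\<And>b c. b \<in> ball (l x) d \<Longrightarrow> c \<in> ball (l x) d \<Longrightarrow> dist (g b) (g c) \<le> dist b c"
      using loc[of "l x"] by blast
    have "dist (g (l a)) (g (l b)) \<le> b - a" if "a \<le> x" "x \<le> b" "b - a < d" for a b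
      using d(2)[of "l a" "l b"] that by (simp add: l(6))
    with d(1) show "\<exists>d>0. \<forall>a b. a \<le> x \<and> x \<le> b \<and> b - a < d \<longrightarrow> dist (g (l a)) (g (l b)) \<le> b - a"
      by blast
  qed simp
  then show ?thesis by (simp add: l)
qed simp

text \<open>Near \<open>a\<close> and near \<open>g a\<close> the covering preserves distances, and
  \<open>\<pi>\<close> after \<open>g\<close> is \<open>\<pi>\<close>; so \<open>g\<close> is
  locally distance-preserving.\<close>

lemma lift_nonexpanding:
  fixes \<pi> :: "hyp_plane \<Rightarrow> 'a::metric_space" and g :: "hyp_plane \<Rightarrow> hyp_plane"
  assumes loc: "locally_isometric \<pi>" and g: "continuous_on UNIV g" "\<And>z. \<pi> (g z) = \<pi> z"
  shows "dist (g p) (g q) \<le> dist p q"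
proof (rule locally_nonexpanding_imp_nonexpanding[of g p q])
  fix a
  obtain U where U: "open U" "a \<in> U" "\<And>b c. b \<in> U \<Longrightarrow> c \<in> U \<Longrightarrow> dist (\<pi> b) (\<pi> c) = dist b c"
    using loc unfolding locally_isometric_def by metis
  obtain V where V: "open V" "g a \<in> V" "\<And>b c. b \<in> V \<Longrightarrow> c \<in> V \<Longrightarrow> dist (\<pi> b) (\<pi> c) = dist b c"
    using loc unfolding locally_isometric_def by metis
  have "open (U \<inter> g -` V)" using g(1) U V by (simp add: open_Int continuous_on_open_vimage[OF open_UNIV])
  moreover have "a \<in> U \<inter> g -` V" using U V by simp
  ultimately obtain d where d: "d > 0" "ball a d \<subseteq> U \<inter> g -` V" by (meson open_contains_ball)
  have "dist (g b) (g c) \<le> dist b c" if "b \<in> ball a d" "c \<in> ball a d" for b c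
  proof -
    have "b \<in> U" "c \<in> U" "g b \<in> V" "g c \<in> V" using that d(2) by auto
    then have "dist (g b) (g c) = dist (\<pi> (g b)) (\<pi> (g c))" "dist (\<pi> b) (\<pi> c) = dist b c"
      using U(3) V(3) by simp_all
    then show ?thesis by (simp add: g(2))
  qed
  with d(1) show "\<exists>d>0. \<forall>b\<in>ball a d. \<forall>c\<in>ball a d. dist (g b) (g c) \<le> dist b c" by blast
qed

text \<open>The lifts taking \<open>p\<close> to \<open>q\<close> and \<open>q\<close> to
  \<open>p\<close> are mutually inverse by uniqueness, and as both are nonexpanding they are
  isometries. The last clause states freeness in the form that injectivity on \<open>T\<close>
  needs.\<close>

lemma deck_transformation:
  assumes cov: "hyperbolic_universal_cover \<pi> F" and pq: "\<pi> p = \<pi> q"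
  obtains g where "site_isometry (\<pi> -` S) g" "g p = q" "\<And>z. g z = z \<Longrightarrow> p = q"
proof -
  have c: "covering_space UNIV \<pi> F" and loc: "locally_isometric \<pi>"
    using cov by (simp_all add: hyperbolic_universal_cover_def)
  obtain g where g: "continuous_on UNIV g" "g p = q" "\<And>z. \<pi> (g z) = \<pi> z"
    using covering_lift_exists[OF c pq] by blast
  obtain h where h: "continuous_on UNIV h" "h q = p" "\<And>z. \<pi> (h z) = \<pi> z"
    using covering_lift_exists[OF c pq[symmetric]] by blast
  have id: "continuous_on UNIV (\<lambda>z::hyp_plane. z)" by (rule continuous_on_id)
  have hg: "(\<lambda>z. h (g z)) = (\<lambda>z. z)"
    by (rule covering_lift_unique[OF c _ _ id, of _ p])
      (auto simp: g h intro!: continuous_on_compose2[OF h(1) g(1)])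
  have gh: "(\<lambda>z. g (h z)) = (\<lambda>z. z)"
    by (rule covering_lift_unique[OF c _ _ id, of _ q])
      (auto simp: g h intro!: continuous_on_compose2[OF g(1) h(1)])
  have hg': "h (g z) = z" and gh': "g (h z) = z" for z using fun_cong[OF hg, of z] fun_cong[OF gh, of z] by simp_all
  have "bij g" using hg' gh' by (metis bijI')
  moreover have "dist (g a) (g b) = dist a b" for a b
    using lift_nonexpanding[OF loc g(1,3), of a b] lift_nonexpanding[OF loc h(1,3), of "g a" "g b"]
    by (simp add: hg')
  moreover have "g ` (\<pi> -` S) = \<pi> -` S"
  proof
    show "\<pi> -` S \<subseteq> g ` (\<pi> -` S)"
    proof
      fix z assume "z \<in> \<pi> -` S"
      then have "h z \<in> \<pi> -` S" by (simp add: h(3))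
      then show "z \<in> g ` (\<pi> -` S)" using gh'[of z] by (metis imageI)
    qed
  qed (auto simp: g(3))
  ultimately have "site_isometry (\<pi> -` S) g" by (simp add: site_isometry_def)
  moreover have "p = q" if "g z = z" for z
  proof -
    have "g = (\<lambda>z. z)" by (rule covering_lift_unique[OF c g(1,3) id, of z]) (simp_all add: that)
    then show ?thesis using g(2) by simp
  qed
  ultimately show thesis using that g(2) by blast
qed

text \<open>Images of balls are open because a covering is an open map; being nested, finitely many
  of them amount to the largest.\<close>

lemma compact_base_fundamental_ball:
  fixes \<pi> :: "hyp_plane \<Rightarrow> 'a::metric_space"
  assumes cov: "covering_space UNIV \<pi> F" and F: "compact F"
  obtains N where "\<And>p. \<exists>q\<in>ball c0 N. \<pi> q = \<pi> p"
proof -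
  let ?C = "range (\<lambda>n::nat. \<pi> ` ball c0 (real n))"
  have cover: "F \<subseteq> \<Union>?C"
  proof
    fix s assume "s \<in> F"
    then obtain p where "s = \<pi> p" using covering_space_imp_surjective[OF cov] by blast
    moreover obtain n :: nat where "dist c0 p < real n" using reals_Archimedean2 by blast
    ultimately have "s \<in> \<pi> ` ball c0 (real n)" by simp
    then show "s \<in> \<Union>?C" by blast
  qed
  have "openin (top_of_set F) (\<pi> ` ball c0 r)" for r
    by (rule covering_space_open_map[OF cov]) simp
  then have "\<forall>c\<in>?C. openin (top_of_set F) c" by blast
  then obtain D where D: "D \<subseteq> ?C" "finite D" "F \<subseteq> \<Union>D"
    using F[unfolded compact_eq_openin_cover] cover by meson
  obtain M where M: "finite M" "D = (\<lambda>n::nat. \<pi> ` ball c0 (real n)) ` M"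
    using finite_subset_image[OF D(2,1)] by auto
  \<comment> \<open>Inserting 0 keeps \<open>Max\<close> meaningful should \<open>M\<close> be
    empty.\<close>
  have "\<exists>q\<in>ball c0 (real (Max (insert 0 M))). \<pi> q = \<pi> p" for p
  proof -
    have "\<pi> p \<in> F" using covering_space_imp_surjective[OF cov] by blast
    then obtain n q where n: "n \<in> M" "q \<in> ball c0 (real n)" "\<pi> q = \<pi> p"
      using D(3) M(2) by (metis (no_types, lifting) UnionE imageE subsetD)
    have "n \<le> Max (insert 0 M)" using n(1) M(1) by simp
    then have "q \<in> ball c0 (real (Max (insert 0 M)))"
      using n(2) by (meson mem_ball of_nat_le_iff order_less_le_trans)
    with n(3) show ?thesis by blast
  qed
  then show thesis by (rule that)
qed

theorem lemma3p6:
  fixes S' T :: "hyp_plane set"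
    and F S :: "'a::metric_space set"
    and \<pi> :: "hyp_plane \<Rightarrow> 'a"
  assumes "closed S'" and "discrete S'"
    and "T \<in> components (\<Union>(noncentered_edges S'))"
  shows "graph_tree (vertices_of S' T) (edges_of S' T) \<and>
    (closed_surface F \<and> hyperbolic_universal_cover \<pi> F \<and> S \<subseteq> F \<and> finite S \<and> S' = \<pi> -` S \<longrightarrow>
       finite (vertices_of S' T) \<and> finite (edges_of S' T) \<and>
       (\<exists>!v. v \<in> vertices_of S' T \<and>
             (\<forall>u \<in> vertices_of S' T - {v}. vor_radius S' v > vor_radius S' u)) \<and>
       (\<exists>g. homeomorphism T (\<pi> ` T) \<pi> g))"
proof (intro conjI impI)
  note S' = assms(1,2) and T = assms(3)
  show "graph_tree (vertices_of S' T) (edges_of S' T)" by (rule graph_tree_component[OF S' T])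
  assume *: "closed_surface F \<and> hyperbolic_universal_cover \<pi> F \<and> S \<subseteq> F \<and> finite S \<and> S' = \<pi> -` S"
  then have F: "compact F" and cov: "hyperbolic_universal_cover \<pi> F" and S'_eq: "S' = \<pi> -` S"
    by (auto simp: closed_surface_def)
  have cov': "covering_space UNIV \<pi> F" using cov by (simp add: hyperbolic_universal_cover_def)
  note deck = deck_transformation[OF cov, where S = S, folded S'_eq]
  obtain N where N: "\<And>p. \<exists>q\<in>ball (hyp_of 0) N. \<pi> q = \<pi> p"
    using compact_base_fundamental_ball[OF cov' F] by blast
  have move: "\<exists>g. site_isometry S' g \<and> g p \<in> ball (hyp_of 0) N" for p
  proof -
    obtain q where q: "q \<in> ball (hyp_of 0) N" "\<pi> p = \<pi> q" using N[of p] by metis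
    obtain g where "site_isometry S' g" "g p = q" using deck[OF q(2)] by blast
    with q show ?thesis by blast
  qed
  obtain x0 where x0: "x0 \<in> S'"
    using in_components_nonempty[OF T] in_components_subset[OF T]
    by (auto simp: noncentered_edges_def vor_edges_def)
  have bdd: "infdist p S' \<le> N + dist (hyp_of 0) x0" for p
  proof -
    obtain g where g: "site_isometry S' g" "g p \<in> ball (hyp_of 0) N" using move by blast
    have "infdist p S' = infdist (g p) S'" using infdist_isometry[OF g(1)] by simp
    also have "\<dots> \<le> dist (g p) x0" by (rule infdist_le[OF x0])
    also have "\<dots> \<le> N + dist (hyp_of 0) x0"
      using dist_triangle3[of "g p" x0 "hyp_of 0"] g(2) by simp
    finally show ?thesis .
  qed
  \<comment> \<open>Heights are invariant under \<open>g\<close>, so each of them already occurs at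
    a vertex in one ball, which contains finitely many vertices.\<close>
  have "(\<lambda>v. infdist v S') ` vor_vertices S'
      \<subseteq> (\<lambda>v. infdist v S') ` (vor_vertices S' \<inter> cball (hyp_of 0) N)"
  proof
    fix r assume "r \<in> (\<lambda>v. infdist v S') ` vor_vertices S'"
    then obtain v where v: "v \<in> vor_vertices S'" "r = infdist v S'" by blast
    obtain g where g: "site_isometry S' g" "g v \<in> ball (hyp_of 0) N" using move by blast
    have "g v \<in> vor_vertices S' \<inter> cball (hyp_of 0) N"
      using g vor_vertices_isometry[OF g(1) v(1)] by auto
    moreover have "r = infdist (g v) S'" using v(2) infdist_isometry[OF g(1)] by simp
    ultimately show "r \<in> (\<lambda>v. infdist v S') ` (vor_vertices S' \<inter> cball (hyp_of 0) N)" by blast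
  qed
  then have "finite ((\<lambda>v. infdist v S') ` vor_vertices S')"
    by (rule finite_subset) (intro finite_imageI finite_vor_vertices_Int_cball[OF S'])
  note comp = component_with_bounded_heights[OF S' bdd this T]
  show "finite (vertices_of S' T)" "finite (edges_of S' T)" by (fact comp)+
  obtain m where m: "m \<in> vertices_of S' T"
    "\<And>u. u \<in> vertices_of S' T \<Longrightarrow> u \<noteq> m \<Longrightarrow> infdist u S' < infdist m S'"
    using comp(4) by blast
  have radius: "vor_radius S' u = infdist u S'" if "u \<in> vertices_of S' T" for u
    using that by (intro vor_radius_eq_infdist) (simp add: vertices_of_def)
  show "\<exists>!v. v \<in> vertices_of S' T \<and>
      (\<forall>u \<in> vertices_of S' T - {v}. vor_radius S' v > vor_radius S' u)"
  proof (rule ex1I[of _ m])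
    show "m \<in> vertices_of S' T \<and> (\<forall>u\<in>vertices_of S' T - {m}. vor_radius S' u < vor_radius S' m)"
      using m radius by simp
    fix v assume v: "v \<in> vertices_of S' T \<and> (\<forall>u\<in>vertices_of S' T - {v}. vor_radius S' u < vor_radius S' v)"
    show "v = m"
    proof (rule ccontr)
      assume "v \<noteq> m"
      then have "vor_radius S' m < vor_radius S' v" using v m(1) by blast
      moreover have "vor_radius S' v < vor_radius S' m" using m v \<open>v \<noteq> m\<close> radius by simp
      ultimately show False by simp
    qed
  qed
  have "inj_on \<pi> T"
  proof (rule inj_onI)
    fix p q assume pq: "p \<in> T" "q \<in> T" "\<pi> p = \<pi> q"
    obtain g where g: "site_isometry S' g" "g p = q" "\<And>z. g z = z \<Longrightarrow> p = q"
      using deck[OF pq(3)] by blast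
    have "continuous_on UNIV g"
      using g(1) unfolding site_isometry_def continuous_on_iff by auto
    then have "connected (g ` T)"
      using in_components_connected[OF T] by (intro connected_continuous_image) (rule continuous_on_subset, auto)
    moreover have "g ` T \<subseteq> \<Union>(noncentered_edges S')"
    proof
      fix r assume "r \<in> g ` T"
      then obtain z e where z: "r = g z" "z \<in> e" "e \<in> noncentered_edges S'"
        using in_components_subset[OF T] by blast
      then show "r \<in> \<Union>(noncentered_edges S')" using noncentered_edges_isometry[OF g(1)] by blast
    qed
    \<comment> \<open>The point \<open>q = g p\<close> lies in both, so the connected image stays in
      the component; this inclusion is enough to keep \<open>g m\<close> in
      \<open>T\<close>.\<close>
    moreover have "T \<inter> g ` T \<noteq> {}" using pq(1,2) g(2) by blast
    ultimately have "g ` T \<subseteq> T" by (rule components_maximal[OF T])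
    then have "g m \<in> vertices_of S' T"
      using m(1) vor_vertices_isometry[OF g(1)] by (auto simp: vertices_of_def)
    then have "g m = m" using m(2)[of "g m"] infdist_isometry[OF g(1), of m] by auto
    then show "p = q" by (rule g(3))
  qed
  moreover have "continuous_on T \<pi>"
    using covering_space_imp_continuous[OF cov'] continuous_on_subset by blast
  \<comment> \<open>A continuous injection of the compact set \<open>T\<close> has a continuous
    inverse.\<close>
  ultimately show "\<exists>g. homeomorphism T (\<pi> ` T) \<pi> g"
    using homeomorphism_compact[OF comp(3)] by blast
qed

end
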